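(* Consider the following problem: for a fixed number $M\ge2$ of quantized subsections of $[-\kappa_y,\kappa_y]=[-\kappa\tilde\theta_1,\kappa\tilde\theta_1]$, find a quantizer $q$ that minimizes $$\mathrm V[U^{\rm T}E]\;(=\mathrm V[\tilde U^{\rm T}E])=\sum_{k=1}^n\mathrm E\Big[\Big(\sum_{t=1}^N\tilde\phi_k(t)e(\tilde\phi_1(t))\Big)^2\Big]=N\int\sigma^2(\tilde\phi_1)\,e^2(\tilde\phi_1)\,f(\tilde\phi_1)\,d\tilde\phi_1$$ such that $\mathrm E_{\mathcal I_j}[\tilde\phi_1e(\tilde\phi_1)]=0$ for all $j$. The optimal ratios $r_j^o$ for this problem (where $d_j=r_jd_{j+1}$, $r_j\in[0,1]$) are given by solving the following recursive optimization problem iteratively: $$r_j^o=\arg\min_{r\in[0,1]}\Big(d_{j+1}^5\,\psi(r;\psi_{j-1}^{\min})+20\,\kappa_y^2(n-1)\,d_{j+1}^3\,\xi(r;\xi_{j-1}^{\min})\Big),$$ $$\psi(r;\alpha)=\alpha r^5-18(1-r)^5+45(1+r)^2(1-r)^3+5(1-r)^7(1+r)^{-2},\qquad\psi_j^{\min}=\psi(r_j^o;\psi_{j-1}^{\min}),\qquad\psi_0^{\min}=32,$$ $$\xi(r;\alpha)=\alpha r^3+3(1-r)^3+\frac{(1-r)^5}{(1+r)^2},\qquad\xi_j^{\min}=\xi(r_j^o;\xi_{j-1}^{\min}),\qquad\xi_0^{\min}=4.$$ The optimal value is given by $$\min_q\mathrm V[U^{\rm T}E]\;\big(=\min_q\mathrm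 V[\tilde U^{\rm T}E]\big)=\min_q\sum_{j=-M'}^{M'}\mathrm V_{\mathcal I_j}[\tilde U^{\rm T}E]=\frac{N}{2160}\kappa_y^4\big(\psi_{M'-1}^{\min}+20(n-1)\xi_{M'-1}^{\min}\big)=\frac{N}{2160}\tilde\theta_1^4\kappa^4\big(\psi_{M'-1}^{\min}+20(n-1)\xi_{M'-1}^{\min}\big).$$
   Context: Setting: $\phi(t)=[u(t)\ u(t-1)\ \cdots\ u(t-n+1)]$ is the regressor vector of the finite impulse response system $y_o(t)=q(y(t))+w(t)$, $y(t)=\phi(t)\theta$, $\theta\in\mathbb R^n$, with noise $w$ independent of the input $u$. $T$ is an orthogonal matrix with $T^{-1}\theta=[\tilde\theta_1,0,\dots,0]^{\rm T}$, and $\tilde\phi=\phi T=[\tilde\phi_1\ \cdots\ \tilde\phi_n]$, so $y=\tilde\theta_1\tilde\phi_1$. $U$ is the matrix with rows $\phi(1),\dots,\phi(N)$, $\tilde U=UT$, $e(t)=q(y(t))-y(t)$ is the quantization error, written $e(\tilde\phi_1)=q(\tilde\theta_1\tilde\phi_1)-\tilde\theta_1\tilde\phi_1$ as a function of $\tilde\phi_1$, $E=[e(1)\cdots e(N)]^{\rm T}$, $N$ is the data length, and $\mathrm V[x]$ is the expectation of $\|x\|_2^2$. Assumption: $f(\phi)$ is a probability density such that the density $f(\tilde\phi)$ of $\tilde\phi$ is uniform in $\tilde\phi_i\in[-\kappa,\kappa]$ with a given $\kappa>0$. $f(\tilde\phi_1)$ is the marginal density, and $\sigma^2(\tilde\phi_1)=f(\tilde\phi_1)^{-1}\int(\sum_{k=1}^n\tilde\phi_k^2)f(\tilde\phi_1,\dots,\tilde\phi_n)\,d\tilde\phi_2\cdots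 d\tilde\phi_n$. Quantizer: $q$ is memoryless and symmetric about the origin, with $0=d_0<d_1<d_2<\cdots<d_{M'}=\kappa_y$, $d_{-j}=-d_j$, $\mathcal S_0=\{0\}$, $\mathcal S_j=(d_{j-1},d_j]$ for $j>0$, $\mathcal S_j=[d_j,d_{j+1})$ for $j<0$, and $q(y)=y'_{\langle j\rangle}$ for $y\in\mathcal S_j$. Here $M'=M/2$ for even $M$ and $M'=(M-1)/2$ for odd $M$ (for odd $M$ the constraint forces the subsection containing the origin to be $\{0\}$, so the problem reduces to the even case). $\mathcal I_j=\{\tilde\phi_1:\tilde\theta_1\tilde\phi_1\in\mathcal S_j\}$, $\mathrm E_{\mathcal I_j}[\tilde\phi_1e(\tilde\phi_1)]=\int_{\mathcal I_j}\tilde\phi_1e(\tilde\phi_1)f(\tilde\phi_1)\,d\tilde\phi_1$, and $\mathrm V_{\mathcal I_j}[\tilde U^{\rm T}E]$ denotes the contribution of $\mathcal I_j$ to the cost, $N\int_{\mathcal I_j}\sigma^2(\tilde\phi_1)e^2(\tilde\phi_1)f(\tilde\phi_1)\,d\tilde\phi_1$. Once the boundaries $d_j$ are fixed, the values $y'_{\langle j\rangle}$ are given by the constraint, so the optimization amounts to determining the ratios $r_1,\dots,r_{M'-1}$. In the recursion $r_j^o$ depends in general on $d_{j+1}$, so the problem is of dynamic programming type.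
   Formalization: The optimal value carries κ_y⁴/θ̃₁² = θ̃₁²κ⁴ in place of the printed κ_y⁴ = θ̃₁⁴κ⁴ (wrong unless θ̃₁=1), and products φ̃_k g(φ̃_1), g bounded, at different times are assumed uncorrelated, without which the cost identity with factor N fails. *)

theory Defs
  imports "HOL-Probability.Probability"
begin

section \<open>Regressors, quantization error and cost\<close>

text \<open>
  The index type \<open>'n\<close> labels the parameters (\<open>n = CARD('n)\<close>), the index type \<open>'N\<close> the sampling
  times (\<open>N = CARD('N)\<close>); \<open>phi t w\<close> is the regressor row at time \<open>t\<close> and outcome \<open>w\<close>.  No shift
  structure \<open>phi(t) = [u(t), \<dots>, u(t-n+1)]\<close> is imposed on the rows, so the regressors of a finite
  impulse response system are a special case.  The additive output noise does not occur, as it does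
  not enter the quantization error.  The coordinate numbered 1 is a fixed index \<open>i1 :: 'n\<close>.
\<close>

definition tregressor :: "real^'n^'n \<Rightarrow> ('N \<Rightarrow> 'w \<Rightarrow> real^'n) \<Rightarrow> 'N \<Rightarrow> 'w \<Rightarrow> real^'n" where
  "tregressor T phi t w = phi t w v* T"

definition Umat :: "('N \<Rightarrow> 'w \<Rightarrow> real^'n) \<Rightarrow> 'w \<Rightarrow> real^'n^'N" where
  "Umat phi w = (\<chi> t. phi t w)"

definition Evec :: "(real \<Rightarrow> real) \<Rightarrow> real^'n \<Rightarrow> ('N \<Rightarrow> 'w \<Rightarrow> real^'n) \<Rightarrow> 'w \<Rightarrow> real^'N" where
  "Evec q theta phi w = (\<chi> t. q (phi t w \<bullet> theta) - phi t w \<bullet> theta)"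

definition V :: "'w measure \<Rightarrow> ('w \<Rightarrow> real^'n) \<Rightarrow> real" where
  "V P X = (\<integral>w. (norm (X w))\<^sup>2 \<partial>P)"

text \<open>
  The error is measured in units of \<open>y = theta1 * x\<close>, so at fixed \<open>kappa\<close> the cost scales with
  \<open>theta1\<^sup>2\<close>: a sum over cells of \<open>\<integral>(y\<^sup>2 + (n-1) kappa_y\<^sup>2/3) (q y - y)\<^sup>2 dy\<close>, of order
  \<open>kappa_y\<^sup>5\<close>, carries the prefactor \<open>N / (2 kappa_y theta1\<^sup>2)\<close>.
\<close>

definition err :: "(real \<Rightarrow> real) \<Rightarrow> real \<Rightarrow> real \<Rightarrow> real" where
  "err q theta1 x = q (theta1 * x) - theta1 * x"

section \<open>Input density\<close>

definition uniform_density :: "real \<Rightarrow> real^'n \<Rightarrow> real" where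
  "uniform_density kappa x =
     (if \<forall>k. x $ k \<in> {-kappa..kappa} then 1 / (2 * kappa) ^ CARD('n) else 0)"

definition insert_coord :: "'n::finite \<Rightarrow> real \<Rightarrow> ('n \<Rightarrow> real) \<Rightarrow> real^'n" where
  "insert_coord i1 x z = (\<chi> k. if k = i1 then x else z k)"

definition marginal :: "'n::finite \<Rightarrow> (real^'n \<Rightarrow> real) \<Rightarrow> real \<Rightarrow> real" where
  "marginal i1 f x = (\<integral>z. f (insert_coord i1 x z) \<partial>(Pi\<^sub>M (- {i1}) (\<lambda>_. lborel)))"

definition sigma2 :: "'n::finite \<Rightarrow> (real^'n \<Rightarrow> real) \<Rightarrow> real \<Rightarrow> real" where
  "sigma2 i1 f x = inverse (marginal i1 f x) *
     (\<integral>z. (\<Sum>k\<in>UNIV. (insert_coord i1 x z $ k)\<^sup>2) * f (insert_coord i1 x z)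
        \<partial>(Pi\<^sub>M (- {i1}) (\<lambda>_. lborel)))"

text \<open>
  No correlation between different times.  This is what removes the products of terms from
  different times in \<open>\<Sum>\<^sub>k E[(\<Sum>\<^sub>t \<phi>\<^sub>k(t) e(\<phi>\<^sub>1(t)))\<^sup>2]\<close>.  It is a condition on the transformed
  regressors \<open>X\<close> alone, holds when \<open>X s\<close> and \<open>X t\<close> are independent for \<open>s \<noteq> t\<close>, and also holds
  for \<open>X(t) = [u(t), \<dots>, u(t-n+1)]\<close> with \<open>u\<close> bounded, independent and of mean zero (\<open>i1\<close> the
  position of \<open>u(t)\<close>), although those rows overlap.
\<close>

definition uncorrelated_in_time ::
    "'w measure \<Rightarrow> 'n::finite \<Rightarrow> ('N \<Rightarrow> 'w \<Rightarrow> real^'n) \<Rightarrow> bool" where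
  "uncorrelated_in_time P i1 X \<longleftrightarrow>
     (\<forall>g \<in> borel_measurable borel. \<forall>k s t. bounded (range g) \<longrightarrow> s \<noteq> t \<longrightarrow>
        (\<integral>w. (X s w $ k * g (X s w $ i1)) * (X t w $ k * g (X t w $ i1)) \<partial>P) =
        (\<integral>w. X s w $ k * g (X s w $ i1) \<partial>P) * (\<integral>w. X t w $ k * g (X t w $ i1) \<partial>P :: real))"

section \<open>Quantizers\<close>

definition cell :: "(int \<Rightarrow> real) \<Rightarrow> int \<Rightarrow> real set" where
  "cell d j = (if j = 0 then {0} else if j > 0 then {d (j - 1)<..d j} else {d j..<d (j + 1)})"

text \<open>
  Here \<open>m\<close> is \<open>M'\<close>.  A quantizer is only prescribed on \<open>[-kappa_y, kappa_y]\<close>; measurability is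
  required because the total function \<open>q\<close> is otherwise arbitrary outside that interval.
\<close>

definition quantizer :: "nat \<Rightarrow> real \<Rightarrow> (int \<Rightarrow> real) \<Rightarrow> (real \<Rightarrow> real) \<Rightarrow> bool" where
  "quantizer m kappa_y d q \<longleftrightarrow>
     q \<in> borel_measurable borel \<and>
     d 0 = 0 \<and> (\<forall>j\<in>{0..<int m}. d j < d (j + 1)) \<and> d (int m) = kappa_y \<and>
     (\<forall>j\<in>{0..int m}. d (- j) = - d j) \<and>
     (\<exists>lev. (\<forall>j\<in>{0..int m}. lev (- j) = - lev j) \<and>
        (\<forall>j\<in>{- int m..int m}. \<forall>y\<in>cell d j. q y = lev j))"

definition I_set :: "real \<Rightarrow> (int \<Rightarrow> real) \<Rightarrow> int \<Rightarrow> real set" where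
  "I_set theta1 d j = {x. theta1 * x \<in> cell d j}"

definition E_I :: "'n::finite \<Rightarrow> (real^'n \<Rightarrow> real) \<Rightarrow> real \<Rightarrow> (int \<Rightarrow> real) \<Rightarrow> (real \<Rightarrow> real) \<Rightarrow> int \<Rightarrow> real" where
  "E_I i1 f theta1 d q j =
     (LINT x:I_set theta1 d j|lborel. x * err q theta1 x * marginal i1 f x)"

definition V_I :: "nat \<Rightarrow> 'n::finite \<Rightarrow> (real^'n \<Rightarrow> real) \<Rightarrow> real \<Rightarrow> (int \<Rightarrow> real) \<Rightarrow> (real \<Rightarrow> real) \<Rightarrow> int \<Rightarrow> real" where
  "V_I N i1 f theta1 d q j = real N *
     (LINT x:I_set theta1 d j|lborel. sigma2 i1 f x * (err q theta1 x)\<^sup>2 * marginal i1 f x)"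

definition feasible ::
    "nat \<Rightarrow> 'n::finite \<Rightarrow> (real^'n \<Rightarrow> real) \<Rightarrow> real \<Rightarrow> real \<Rightarrow> (int \<Rightarrow> real) \<Rightarrow> (real \<Rightarrow> real) \<Rightarrow> bool" where
  "feasible m i1 f theta1 kappa_y d q \<longleftrightarrow>
     quantizer m kappa_y d q \<and> (\<forall>j\<in>{- int m..int m}. E_I i1 f theta1 d q j = 0)"

text \<open>The boundaries \<open>d\<close> are carried along since the constraint and the ratios refer to them.\<close>

definition optimal ::
    "'w measure \<Rightarrow> ('N::finite \<Rightarrow> 'w \<Rightarrow> real^'n::finite) \<Rightarrow> real^'n \<Rightarrow> nat \<Rightarrow> 'n \<Rightarrow> (real^'n \<Rightarrow> real) \<Rightarrow>
     real \<Rightarrow> real \<Rightarrow> (int \<Rightarrow> real) \<Rightarrow> (real \<Rightarrow> real) \<Rightarrow> bool" where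
  "optimal P phi theta m i1 f theta1 kappa_y d q \<longleftrightarrow>
     is_arg_min (\<lambda>(d, q). V P (\<lambda>w. transpose (Umat phi w) *v Evec q theta phi w))
       (\<lambda>(d, q). feasible m i1 f theta1 kappa_y d q) (d, q)"

section \<open>The recursion for the ratios\<close>

definition psi :: "real \<Rightarrow> real \<Rightarrow> real" where
  "psi r a = a * r ^ 5 - 18 * (1 - r) ^ 5 + 45 * (1 + r)\<^sup>2 * (1 - r) ^ 3
             + 5 * (1 - r) ^ 7 / (1 + r)\<^sup>2"

definition xi :: "real \<Rightarrow> real \<Rightarrow> real" where
  "xi r a = a * r ^ 3 + 3 * (1 - r) ^ 3 + (1 - r) ^ 5 / (1 + r)\<^sup>2"

text \<open>
  Dynamic programming: \<open>ro j d\<close> is the ratio \<open>r\<^sub>j\<^sup>o\<close> as a function of \<open>d = d\<^sub>j\<^sub>+\<^sub>1\<close>, so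
  \<open>\<psi>\<^sub>j\<^sup>m\<^sup>i\<^sup>n\<close> and \<open>\<xi>\<^sub>j\<^sup>m\<^sup>i\<^sup>n\<close> are functions of \<open>d\<^sub>j\<^sub>+\<^sub>1\<close> as well, and a trial ratio \<open>r\<close> in stage \<open>j\<close>
  evaluates \<open>\<psi>\<^bsub>j-1\<^esub>\<^sup>m\<^sup>i\<^sup>n\<close> and \<open>\<xi>\<^bsub>j-1\<^esub>\<^sup>m\<^sup>i\<^sup>n\<close> at \<open>d\<^sub>j = r d\<^sub>j\<^sub>+\<^sub>1\<close>.
\<close>

primrec psi_min :: "(nat \<Rightarrow> real \<Rightarrow> real) \<Rightarrow> nat \<Rightarrow> real \<Rightarrow> real" where
  "psi_min ro 0 d = 32"
| "psi_min ro (Suc j) d = psi (ro (Suc j) d) (psi_min ro j (ro (Suc j) d * d))"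

primrec xi_min :: "(nat \<Rightarrow> real \<Rightarrow> real) \<Rightarrow> nat \<Rightarrow> real \<Rightarrow> real" where
  "xi_min ro 0 d = 4"
| "xi_min ro (Suc j) d = xi (ro (Suc j) d) (xi_min ro j (ro (Suc j) d * d))"

definition stage :: "nat \<Rightarrow> real \<Rightarrow> (nat \<Rightarrow> real \<Rightarrow> real) \<Rightarrow> nat \<Rightarrow> real \<Rightarrow> real \<Rightarrow> real" where
  "stage n kappa_y ro j d r =
     d ^ 5 * psi r (psi_min ro (j - 1) (r * d))
     + 20 * kappa_y\<^sup>2 * (real n - 1) * d ^ 3 * xi r (xi_min ro (j - 1) (r * d))"

definition solves_recursion :: "nat \<Rightarrow> real \<Rightarrow> nat \<Rightarrow> (nat \<Rightarrow> real \<Rightarrow> real) \<Rightarrow> bool" where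
  "solves_recursion n kappa_y m ro \<longleftrightarrow>
     (\<forall>j\<in>{1..<m}. \<forall>d\<in>{0<..kappa_y}.
        is_arg_min (stage n kappa_y ro j d) (\<lambda>r. r \<in> {0..1}) (ro j d))"

end

theory Submission
  imports Defs
begin

text \<open>
  Three reductions turn the minimization over quantizers into a dynamic program.

  \<^item> In the coordinates rotated by \<open>T\<close> the quantization error depends on the coordinate \<open>i1\<close> alone. The
    mixed terms for different times factor by uncorrelatedness, and each factor vanishes: for the
    coordinate \<open>i1\<close> by the constraint, summed over the cells, and for the other coordinates because
    they have mean zero given the coordinate \<open>i1\<close>. So the cost is \<open>N \<integral> \<sigma>\<^sup>2 e\<^sup>2 f\<close>, with \<open>\<sigma>\<^sup>2\<close> equal to
    \<open>x\<^sup>2 + (n - 1) kappa\<^sup>2 / 3\<close> on the support (\<open>cost_of_time_sum\<close>, \<open>sigma2_marginal_uniform\<close>).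

  \<^item> The constraint determines the level of every cell with \<open>j \<noteq> 0\<close> by its endpoints, and hence its cost.
    By symmetry the total cost is a constant times the sum of \<open>cell_cost\<close> over the positive cells, and
    every strictly increasing sequence of boundaries occurs (\<open>cost_sum_cells\<close>, \<open>feasible_exists\<close>).

  \<^item> A sum of costs of consecutive intervals is minimized by dynamic programming. The objective of a
    stage of the recursion is the value of the previous stage plus the cost of the last cell
    (\<open>stage_eq_recursion_value\<close>), so every solution of the recursion computes the value function
    \<open>opt_cost\<close>, and a sequence of boundaries is optimal iff all its ratios minimize their stages
    (\<open>opt_cost_chain\<close>).

  Two analytic facts make this work for genuine quantizers. The value functions are continuous, so
  the minima exist (\<open>continuous_on_opt_cost\<close>). And splitting a cell at its midpoint strictly lowers the
  cost, so the minimizing ratios are neither \<open>0\<close> nor \<open>1\<close> (\<open>arg_min_trial_cost_interior\<close>) and the optimal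
  boundaries are strictly increasing.
\<close>

section \<open>The cost of one cell\<close>

text \<open>
  This is \<open>2160\<close> times \<open>\<integral> (y\<^sup>2 + mu / 60) (l - y)\<^sup>2 dy\<close> over \<open>[a, b]\<close>, where the level
  \<open>l = 2 (a\<^sup>2 + a b + b\<^sup>2) / (3 (a + b))\<close> is the one that the constraint \<open>\<integral> y (l - y) dy = 0\<close> dictates.
  With \<open>mu = 20 kappa_y\<^sup>2 (n - 1)\<close> the weight is, up to the factor \<open>theta1\<^sup>2\<close>, the conditional second
  moment \<open>\<sigma>\<^sup>2\<close> of the regressor.
\<close>

definition cell_cost :: "real \<Rightarrow> real \<Rightarrow> real \<Rightarrow> real" where
  "cell_cost mu a b = 45 * (a + b)\<^sup>2 * (b - a) ^ 3 - 18 * (b - a) ^ 5 + 5 * (b - a) ^ 7 / (a + b)\<^sup>2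
     + mu * (3 * (b - a) ^ 3 + (b - a) ^ 5 / (a + b)\<^sup>2)"

lemma cell_cost_centered:
  assumes "m \<noteq> 0"
  shows "cell_cost mu (m - h) (m + h) =
     1440 * m\<^sup>2 * h ^ 3 - 576 * h ^ 5 + 160 * h ^ 7 / m\<^sup>2 + mu * (24 * h ^ 3 + 8 * h ^ 5 / m\<^sup>2)"
proof -
  have 1: "m - h + (m + h) = 2 * m" "m + h - (m - h) = 2 * h" by auto
  show ?thesis
    unfolding cell_cost_def 1 power_mult_distrib using assms by (simp add: field_simps)
qed

text \<open>
  The levels are prescribed by the constraint instead of minimizing the weighted error, so a finer
  partition need not be cheaper for trivial reasons. It is for the midpoint \<open>m\<close> of an interval of
  half-length \<open>h\<close>: the leading terms \<open>m\<^sup>2 h\<^sup>3\<close> and \<open>h\<^sup>3\<close> shrink by a factor of about \<open>4\<close>, and since \<open>h \<le> m\<close>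
  the other terms cannot make up for it.
\<close>

lemma cell_cost_midpoint_less:
  assumes "0 \<le> a" "a < b" "0 \<le> mu"
  shows "cell_cost mu a ((a + b) / 2) + cell_cost mu ((a + b) / 2) b < cell_cost mu a b"
proof -
  define m h where "m = (a + b) / 2" and "h = (b - a) / 2"
  have h: "0 < h" "h \<le> m" and ab: "a = m - h" "b = m + h" and m: "m > 0"
    using assms by (auto simp: m_def h_def field_simps)
  \<comment> \<open>the two halves have the midpoints \<open>m \<plusminus> h / 2\<close>, both of which are at least \<open>m / 2\<close>\<close>
  have lo: "1 / (m - h / 2)\<^sup>2 \<le> 4 / m\<^sup>2" and hi: "1 / (m + h / 2)\<^sup>2 \<le> 4 / m\<^sup>2"
  proof -
    have "(m / 2)\<^sup>2 \<le> (m - h / 2)\<^sup>2" "(m / 2)\<^sup>2 \<le> (m + h / 2)\<^sup>2"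
      using h m by (auto intro!: power_mono)
    moreover have "(m - h / 2)\<^sup>2 > 0" "(m + h / 2)\<^sup>2 > 0" using h m by auto
    ultimately show "1 / (m - h / 2)\<^sup>2 \<le> 4 / m\<^sup>2" "1 / (m + h / 2)\<^sup>2 \<le> 4 / m\<^sup>2"
      using m by (auto simp: power_divide field_simps)
  qed
  have half: "cell_cost mu (c - h / 2) (c + h / 2) \<le>
      180 * c\<^sup>2 * h ^ 3 - 18 * h ^ 5 + 5 * h ^ 7 / m\<^sup>2 + mu * (3 * h ^ 3 + h ^ 5 / m\<^sup>2)"
    if "c > 0" "1 / c\<^sup>2 \<le> 4 / m\<^sup>2" for c
  proof -
    have "cell_cost mu (c - h / 2) (c + h / 2) =
      180 * c\<^sup>2 * h ^ 3 - 18 * h ^ 5 + (5 / 4) * h ^ 7 * (1 / c\<^sup>2) + mu * (3 * h ^ 3 + (1 / 4) * h ^ 5 * (1 / c\<^sup>2))"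
      using that by (simp add: cell_cost_centered power_divide)
    also have "\<dots> \<le> 180 * c\<^sup>2 * h ^ 3 - 18 * h ^ 5 + (5 / 4) * h ^ 7 * (4 / m\<^sup>2)
        + mu * (3 * h ^ 3 + (1 / 4) * h ^ 5 * (4 / m\<^sup>2))"
      using that h assms by (intro add_mono mult_left_mono diff_mono) auto
    finally show ?thesis by simp
  qed
  have "cell_cost mu a ((a + b) / 2) + cell_cost mu ((a + b) / 2) b
      = cell_cost mu (m - h / 2 - h / 2) (m - h / 2 + h / 2)
        + cell_cost mu (m + h / 2 - h / 2) (m + h / 2 + h / 2)"
    by (intro arg_cong2[where f = "(+)"] arg_cong2[where f = "cell_cost mu"]) (auto simp: ab)
  also have "\<dots> \<le> 180 * ((m - h / 2)\<^sup>2 + (m + h / 2)\<^sup>2) * h ^ 3 - 36 * h ^ 5 + 10 * h ^ 7 / m\<^sup>2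
      + mu * (6 * h ^ 3 + 2 * h ^ 5 / m\<^sup>2)"
    using add_mono[OF half[OF _ lo] half[OF _ hi]] h m by (simp add: algebra_simps)
  also have "180 * ((m - h / 2)\<^sup>2 + (m + h / 2)\<^sup>2) * h ^ 3 = 360 * m\<^sup>2 * h ^ 3 + 90 * h ^ 5"
    by (simp add: power2_eq_square eval_nat_numeral algebra_simps)
  also have "\<dots> - 36 * h ^ 5 + 10 * h ^ 7 / m\<^sup>2 + mu * (6 * h ^ 3 + 2 * h ^ 5 / m\<^sup>2)
      < 1440 * m\<^sup>2 * h ^ 3 - 576 * h ^ 5 + 160 * h ^ 7 / m\<^sup>2 + mu * (24 * h ^ 3 + 8 * h ^ 5 / m\<^sup>2)"
  proof -
    have "h ^ 5 \<le> m\<^sup>2 * h ^ 3"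
      using h mult_right_mono[OF power_mono[of h m 2], of "h ^ 3"]
      by (simp add: power_add[symmetric])
    moreover have "0 < h ^ 5" "0 \<le> h ^ 7 / m\<^sup>2" using h by auto
    moreover have "mu * (6 * h ^ 3 + 2 * h ^ 5 / m\<^sup>2) \<le> mu * (24 * h ^ 3 + 8 * h ^ 5 / m\<^sup>2)"
      using h assms by (intro mult_left_mono add_mono divide_right_mono) auto
    ultimately show ?thesis by linarith
  qed
  also have "\<dots> = cell_cost mu a b" unfolding ab by (simp only: cell_cost_centered[OF less_imp_neq[OF m, symmetric]])
  finally show ?thesis .
qed

lemma cell_cost_scale:
  assumes "s > 0"
  shows "cell_cost (mu * s\<^sup>2) (s * a) (s * b) = s ^ 5 * cell_cost mu a b"
proof -
  define p q where "p = a + b" and "q = b - a"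
  have 1: "s * a + s * b = s * p" "s * b - s * a = s * q" by (auto simp: p_def q_def algebra_simps)
  have 2: "mu * s\<^sup>2 * (3 * (s ^ 3 * q ^ 3) + s ^ 5 * q ^ 5 / (s\<^sup>2 * p\<^sup>2)) =
    s ^ 5 * (mu * (3 * q ^ 3 + q ^ 5 / p\<^sup>2))"
    using assms by (cases "p = 0") (simp_all add: field_simps eval_nat_numeral)
  have 3: "45 * (s\<^sup>2 * p\<^sup>2) * (s ^ 3 * q ^ 3) - 18 * (s ^ 5 * q ^ 5) + 5 * (s ^ 7 * q ^ 7) / (s\<^sup>2 * p\<^sup>2) =
    s ^ 5 * (45 * p\<^sup>2 * q ^ 3 - 18 * q ^ 5 + 5 * q ^ 7 / p\<^sup>2)"
    using assms by (cases "p = 0") (simp_all add: field_simps eval_nat_numeral)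
  show ?thesis
    unfolding cell_cost_def 1 power_mult_distrib p_def[symmetric] q_def[symmetric] 2 3
    by (simp only: distrib_left)
qed

text \<open>
  The polynomials \<open>psi\<close> and \<open>xi\<close> are the two parts of the cost of the cell \<open>[r, 1]\<close>, of degrees five
  and three in the length scale.
\<close>

lemma cell_cost_ratio:
  assumes "0 \<le> r" "0 \<le> d"
  shows "cell_cost mu (r * d) d = d ^ 5 * psi r 0 + mu * d ^ 3 * xi r 0"
proof (cases "d = 0")
  case True
  then show ?thesis by (simp add: cell_cost_def)
next
  case False
  then have "cell_cost mu (r * d) d = d ^ 5 * cell_cost (mu / d\<^sup>2) r 1"
    using cell_cost_scale[of d "mu / d\<^sup>2" r 1] assms by (simp add: mult.commute)
  also have "\<dots> = d ^ 5 * (psi r 0 + mu / d\<^sup>2 * xi r 0)"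
    by (simp add: cell_cost_def psi_def xi_def add.commute)
  also have "\<dots> = d ^ 5 * psi r 0 + (d ^ 5 / d\<^sup>2) * mu * xi r 0"
    by (simp add: distrib_left)
  also have "d ^ 5 / d\<^sup>2 = d ^ 3" using False by (simp add: eval_nat_numeral)
  finally show ?thesis by (simp add: mult.commute)
qed

lemma cell_cost_reflect: "cell_cost mu (- b) (- a) = cell_cost mu a b"
proof -
  have "(- b - a)\<^sup>2 = (a + b)\<^sup>2" by (simp add: power2_eq_square algebra_simps)
  moreover have "- a + b = b - a" by simp
  ultimately show ?thesis by (simp add: cell_cost_def)
qed

lemma cell_cost_diagonal: "cell_cost mu a a = 0"
  by (simp add: cell_cost_def)

section \<open>The dynamic program for the boundaries\<close>

text \<open>
  By uniform continuity, \<open>f x\<close> and \<open>f y\<close> are uniformly close on \<open>A\<close> when \<open>x\<close> and \<open>y\<close> are close, and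
  then so are their minima.
\<close>

lemma continuous_on_INF_compact:
  fixes f :: "'a::metric_space \<Rightarrow> 'b::metric_space \<Rightarrow> real"
  assumes "compact S" "compact A" "A \<noteq> {}"
    and cont: "continuous_on (S \<times> A) (\<lambda>(x, a). f x a)"
  shows "continuous_on S (\<lambda>x. INF a\<in>A. f x a)"
proof -
  have unif: "uniformly_continuous_on (S \<times> A) (\<lambda>(x, a). f x a)"
    using assms by (intro compact_uniformly_continuous compact_Times)
  have attained: "\<exists>a\<in>A. (INF a\<in>A. f x a) = f x a \<and> (\<forall>b\<in>A. f x a \<le> f x b)" if "x \<in> S" for x
  proof -
    have "continuous_on A (\<lambda>a. (\<lambda>(x, a). f x a) (x, a))"
      using that by (intro continuous_on_compose2[OF cont] continuous_intros) auto
    then obtain a where a: "a \<in> A" "\<forall>b\<in>A. f x a \<le> f x b"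
      using continuous_attains_inf[of A "f x"] assms by auto
    then have "(INF a\<in>A. f x a) = f x a" by (intro cInf_eq_minimum) auto
    then show ?thesis using a by blast
  qed
  have one_sided: "(INF a\<in>A. f y a) < (INF a\<in>A. f x a) + e"
    if x: "x \<in> S" and y: "y \<in> S" and close: "\<forall>a\<in>A. dist (f y a) (f x a) < e" for x y e
  proof -
    obtain a where a: "a \<in> A" "(INF a\<in>A. f x a) = f x a" using attained[OF x] by blast
    obtain b where b: "(INF a\<in>A. f y a) = f y b" "\<forall>c\<in>A. f y b \<le> f y c"
      using attained[OF y] by blast
    have "f y b \<le> f y a" using a b by blast
    also have "\<dots> < f x a + e" using close a by (force simp: dist_real_def)
    finally show ?thesis using a b by simp
  qed
  show ?thesis unfolding continuous_on_iff
  proof (intro ballI allI impI)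
    fix x and e :: real assume x: "x \<in> S" and e: "0 < e"
    obtain D where D: "D > 0" and close:
      "\<And>p q. p \<in> S \<times> A \<Longrightarrow> q \<in> S \<times> A \<Longrightarrow> dist q p < D \<Longrightarrow>
         dist ((\<lambda>(x, a). f x a) q) ((\<lambda>(x, a). f x a) p) < e"
      using unif e unfolding uniformly_continuous_on_def by metis
    have "dist (INF a\<in>A. f y a) (INF a\<in>A. f x a) < e" if y: "y \<in> S" "dist y x < D" for y
    proof -
      have *: "\<forall>a\<in>A. dist (f y a) (f x a) < e"
      proof
        fix a assume "a \<in> A"
        then show "dist (f y a) (f x a) < e"
          using close[of "(x, a)" "(y, a)"] x y by (auto simp: dist_Pair_Pair)
      qed
      have "(INF a\<in>A. f y a) < (INF a\<in>A. f x a) + e" using one_sided[OF x y(1) *] .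
      moreover have "(INF a\<in>A. f x a) < (INF a\<in>A. f y a) + e"
        using one_sided[OF y(1) x] * by (simp add: dist_commute)
      ultimately show ?thesis by (simp add: dist_real_def)
    qed
    then show "\<exists>D>0. \<forall>y\<in>S. dist y x < D \<longrightarrow> dist (INF a\<in>A. f y a) (INF a\<in>A. f x a) < e"
      using D by blast
  qed
qed

text \<open>
  The value function: the least total cost of dividing \<open>[0, d]\<close> into \<open>j + 1\<close> cells, where cells of
  length zero are admitted.
\<close>

primrec opt_cost :: "real \<Rightarrow> nat \<Rightarrow> real \<Rightarrow> real" where
  "opt_cost mu 0 d = cell_cost mu 0 d"
| "opt_cost mu (Suc j) d = (INF r\<in>{0..1}. opt_cost mu j (r * d) + cell_cost mu (r * d) d)"

declare opt_cost.simps(2) [simp del]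

text \<open>
  The objective of the stage that divides \<open>[0, d]\<close> into \<open>j + 2\<close> cells, with last inner boundary \<open>r d\<close>.
\<close>

definition trial_cost :: "real \<Rightarrow> nat \<Rightarrow> real \<Rightarrow> real \<Rightarrow> real" where
  "trial_cost mu j d r = opt_cost mu j (r * d) + cell_cost mu (r * d) d"

lemma opt_cost_Suc: "opt_cost mu (Suc j) d = (INF r\<in>{0..1}. trial_cost mu j d r)"
  by (simp add: trial_cost_def opt_cost.simps(2))

lemma opt_cost_zero: "opt_cost mu j 0 = 0"
  by (induction j) (auto simp: cell_cost_def opt_cost.simps(2))

lemma continuous_on_cell_cost_ratio:
  "continuous_on ({0..} \<times> {0..}) (\<lambda>(d, r). cell_cost mu (r * d) d)"
proof -
  have "continuous_on ({0..} \<times> {0..}) (\<lambda>(d, r). d ^ 5 * psi r 0 + mu * d ^ 3 * xi r 0)"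
    unfolding psi_def xi_def case_prod_beta by (intro continuous_intros) auto
  then show ?thesis
    by (rule continuous_on_eq) (auto simp: cell_cost_ratio)
qed

text \<open>
  Continuity of the value function passes from one stage to the next and is what makes the minimum
  over the ratio attained in every stage.
\<close>

lemma continuous_on_opt_cost:
  assumes "0 \<le> K"
  shows "continuous_on {0..K} (opt_cost mu j)"
    and "continuous_on ({0..K} \<times> {0..1}) (\<lambda>(d, r). trial_cost mu j d r)"
proof -
  have trial: "continuous_on ({0..K} \<times> {0..1}) (\<lambda>(d, r). trial_cost mu j d r)"
    if "continuous_on {0..K} (opt_cost mu j)" for j
  proof -
    have "continuous_on ({0..K} \<times> {0..1}) (\<lambda>p. opt_cost mu j (snd p * fst p))"
      by (rule continuous_on_compose2[OF that])
        (auto intro!: continuous_intros intro: mult_le_one mult_left_le_one_le order_trans[OF mult_left_le_one_le])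
    moreover have "continuous_on ({0..K} \<times> {0..1}) (\<lambda>(d, r). cell_cost mu (r * d) d)"
      by (rule continuous_on_subset[OF continuous_on_cell_cost_ratio]) auto
    ultimately show ?thesis
      unfolding trial_cost_def case_prod_beta by (rule continuous_on_add)
  qed
  show opt: "continuous_on {0..K} (opt_cost mu j)"
  proof (induction j)
    case 0
    have "continuous_on {0..K} (\<lambda>d. (\<lambda>(d, r). cell_cost mu (r * d) d) (d, 0))"
      by (rule continuous_on_compose2[OF continuous_on_cell_cost_ratio]) (auto intro!: continuous_intros)
    then show ?case by simp
  next
    case (Suc j)
    have "continuous_on {0..K} (\<lambda>d. INF r\<in>{0..1}. trial_cost mu j d r)"
      using trial[OF Suc] by (intro continuous_on_INF_compact) auto
    then show ?case by (simp add: opt_cost_Suc)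
  qed
  show "continuous_on ({0..K} \<times> {0..1}) (\<lambda>(d, r). trial_cost mu j d r)"
    by (rule trial[OF opt])
qed

lemma trial_cost_attains_min:
  assumes "0 \<le> d"
  shows "\<exists>r\<in>{0..1}. \<forall>s\<in>{0..1}. trial_cost mu j d r \<le> trial_cost mu j d s"
proof -
  have "continuous_on {0..1} (\<lambda>r. (\<lambda>(d, r). trial_cost mu j d r) (d, r))"
    using assms
    by (intro continuous_on_compose2[OF continuous_on_opt_cost(2)[of d]] continuous_intros) auto
  then show ?thesis
    using continuous_attains_inf[of "{0..1::real}" "trial_cost mu j d"] by auto
qed

lemma is_arg_min_iff_le:
  fixes f :: "'a \<Rightarrow> 'b::linorder"
  shows "is_arg_min f P x \<longleftrightarrow> P x \<and> (\<forall>y. P y \<longrightarrow> f x \<le> f y)"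
  by (auto simp: is_arg_min_def not_less)

lemma opt_cost_le_trial:
  assumes "0 \<le> d" "r \<in> {0..1}"
  shows "opt_cost mu (Suc j) d \<le> trial_cost mu j d r"
proof -
  have "bdd_below (trial_cost mu j d ` {0..1})"
    using trial_cost_attains_min[OF assms(1), of mu j] by (auto simp: bdd_below_def)
  then show ?thesis
    using assms cINF_lower[of "trial_cost mu j d" "{0..1}" r] by (simp add: opt_cost_Suc)
qed

lemma is_arg_min_trial_cost_iff:
  assumes "0 \<le> d"
  shows "is_arg_min (trial_cost mu j d) (\<lambda>r. r \<in> {0..1}) r \<longleftrightarrow>
    r \<in> {0..1} \<and> trial_cost mu j d r = opt_cost mu (Suc j) d"
proof -
  obtain s where s: "s \<in> {0..1}" "\<forall>t\<in>{0..1}. trial_cost mu j d s \<le> trial_cost mu j d t"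
    using trial_cost_attains_min[OF assms] by blast
  then have "opt_cost mu (Suc j) d = trial_cost mu j d s"
    unfolding opt_cost_Suc by (intro cInf_eq_minimum) auto
  then show ?thesis using s unfolding is_arg_min_iff_le by (force intro: antisym)
qed

text \<open>
  Putting the last inner boundary at \<open>d / 2\<close> and leaving \<open>[0, d / 2]\<close> in one piece already beats a single cell.
\<close>

lemma opt_cost_less_cell_cost:
  assumes "0 \<le> mu" "0 < d"
  shows "opt_cost mu j d \<le> cell_cost mu 0 d" "opt_cost mu (Suc j) d < cell_cost mu 0 d"
proof -
  have le: "opt_cost mu j d \<le> cell_cost mu 0 d" if "0 < d" for j d
  proof (cases j)
    case (Suc i)
    then show ?thesis
      using opt_cost_le_trial[of d 0 mu i] that by (simp add: trial_cost_def opt_cost_zero)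
  qed auto
  then show "opt_cost mu j d \<le> cell_cost mu 0 d" using assms by blast
  have "opt_cost mu (Suc j) d \<le> trial_cost mu j d (1 / 2)"
    using assms by (intro opt_cost_le_trial) auto
  also have "\<dots> \<le> cell_cost mu 0 (d / 2) + cell_cost mu (d / 2) d"
    using le[of "d / 2" j] assms by (simp add: trial_cost_def)
  also have "\<dots> < cell_cost mu 0 d"
    using cell_cost_midpoint_less[of 0 d mu] assms by simp
  finally show "opt_cost mu (Suc j) d < cell_cost mu 0 d" .
qed

text \<open>
  Quantizers have strictly increasing boundaries, whereas the recursion admits the ratios \<open>0\<close> and \<open>1\<close>.
  Both would waste a cell. With ratio \<open>0\<close> the interval \<open>[0, d]\<close> is a single cell. With ratio \<open>1\<close> the last
  cell is empty, and splitting the last nonempty cell at its midpoint uses the same number of cells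
  at a smaller cost; the induction hypothesis is what guarantees that this cell is not empty.
\<close>

lemma arg_min_trial_cost_interior:
  assumes "0 \<le> mu" "0 < d" "is_arg_min (trial_cost mu j d) (\<lambda>r. r \<in> {0..1}) r"
  shows "0 < r" "r < 1"
proof -
  have pos_less: "0 < r \<and> r < 1"
    if "0 < d" "is_arg_min (trial_cost mu j d) (\<lambda>r. r \<in> {0..1}) r" for j d r
    using that
  proof (induction j arbitrary: d r)
    case 0
    then have r: "r \<in> {0..1}" "trial_cost mu 0 d r = opt_cost mu (Suc 0) d"
      using is_arg_min_trial_cost_iff[of d mu 0 r] by simp_all
    moreover have "opt_cost mu (Suc 0) d < cell_cost mu 0 d"
      using opt_cost_less_cell_cost 0 assms by blast
    ultimately have "r \<noteq> 0" "r \<noteq> 1"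
      by (auto simp: trial_cost_def cell_cost_diagonal)
    then show ?case using r by auto
  next
    case (Suc j)
    then have r: "r \<in> {0..1}" "trial_cost mu (Suc j) d r = opt_cost mu (Suc (Suc j)) d"
      using is_arg_min_trial_cost_iff[of d mu "Suc j" r] by simp_all
    have "r \<noteq> 0"
      using r opt_cost_less_cell_cost(2)[OF assms(1) \<open>0 < d\<close>, of "Suc j"]
      by (auto simp: trial_cost_def opt_cost_zero)
    moreover have "r \<noteq> 1"
    proof
      assume "r = 1"
      then have top: "opt_cost mu (Suc (Suc j)) d = opt_cost mu (Suc j) d"
        using r by (simp add: trial_cost_def cell_cost_diagonal)
      obtain s where s: "is_arg_min (trial_cost mu j d) (\<lambda>r. r \<in> {0..1}) s"
        using trial_cost_attains_min[of d mu j] Suc.prems(1) less_imp_le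
        unfolding is_arg_min_iff_le by blast
      then have s01: "0 < s" "s < 1" using Suc.IH Suc.prems by blast+
      have opt: "opt_cost mu (Suc j) d = trial_cost mu j d s"
        using s Suc.prems is_arg_min_trial_cost_iff[of d mu j s] by simp
      define c where "c = (s * d + d) / 2"
      have c: "0 < c" "c < d" "s * d < c"
        using s01 Suc.prems by (auto simp: c_def field_simps intro: add_pos_pos)
      have "opt_cost mu (Suc (Suc j)) d \<le> trial_cost mu (Suc j) d (c / d)"
        using c by (intro opt_cost_le_trial) auto
      also have "\<dots> = opt_cost mu (Suc j) c + cell_cost mu c d"
        using c by (simp add: trial_cost_def)
      also have "opt_cost mu (Suc j) c \<le> trial_cost mu j c (s * d / c)"
        using c s01 by (intro opt_cost_le_trial) auto
      also have "\<dots> = opt_cost mu j (s * d) + cell_cost mu (s * d) c"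
        using c by (simp add: trial_cost_def)
      also have "\<dots> + cell_cost mu c d < opt_cost mu j (s * d) + cell_cost mu (s * d) d"
        using cell_cost_midpoint_less[of "s * d" d mu] c s01 assms(1) Suc.prems
        by (simp add: c_def)
      also have "\<dots> = opt_cost mu (Suc j) d" using opt by (simp add: trial_cost_def)
      finally show False using top by simp
    qed
    ultimately show ?case using r by auto
  qed
  show "0 < r" "r < 1" using pos_less[OF assms(2,3)] by auto
qed

section \<open>The recursion for the ratios as a value iteration\<close>

text \<open>
  The recursion tracks the parts of degree five and three separately; only this combination of them
  is optimized, and it alone does not depend on the choice among several minimizers.
\<close>

definition recursion_value :: "real \<Rightarrow> (nat \<Rightarrow> real \<Rightarrow> real) \<Rightarrow> nat \<Rightarrow> real \<Rightarrow> real" where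
  "recursion_value mu ro j d = d ^ 5 * psi_min ro j d + mu * d ^ 3 * xi_min ro j d"

lemma psi_affine: "psi r a = a * r ^ 5 + psi r 0" and xi_affine: "xi r a = a * r ^ 3 + xi r 0"
  by (simp_all add: psi_def xi_def)

text \<open>
  Since \<open>psi\<close> and \<open>xi\<close> are affine in \<open>\<alpha>\<close> with slopes \<open>r\<^sup>5\<close> and \<open>r\<^sup>3\<close>, the \<open>\<alpha>\<close>-terms recombine to the value of
  the previous stage at \<open>r d\<close>.
\<close>

lemma stage_eq_recursion_value:
  assumes "0 \<le> r" "0 \<le> d"
  shows "stage n K ro (Suc j) d r =
    recursion_value (20 * K\<^sup>2 * (real n - 1)) ro j (r * d)
      + cell_cost (20 * K\<^sup>2 * (real n - 1)) (r * d) d"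
  unfolding stage_def recursion_value_def cell_cost_ratio[OF assms]
    psi_affine[of r "psi_min _ _ _"] xi_affine[of r "xi_min _ _ _"]
  by (simp add: power_mult_distrib algebra_simps)

lemma recursion_value_Suc:
  "recursion_value (20 * K\<^sup>2 * (real n - 1)) ro (Suc j) d = stage n K ro (Suc j) d (ro (Suc j) d)"
  by (simp add: recursion_value_def stage_def)

lemma recursion_value_zero:
  assumes "0 \<le> d"
  shows "recursion_value mu ro 0 d = cell_cost mu 0 d"
  using cell_cost_ratio[of 0 d mu] assms by (simp add: recursion_value_def psi_def xi_def)

text \<open>
  Every solution of the recursion computes the same value function, whichever minimizers it selects.
\<close>

lemma recursion_value_eq_opt_cost:
  assumes "mu = 20 * K\<^sup>2 * (real n - 1)"
    and "\<forall>j\<in>{1..k}. \<forall>d\<in>{0<..K}. is_arg_min (stage n K ro j d) (\<lambda>r. r \<in> {0..1}) (ro j d)"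
    and "d \<in> {0..K}"
  shows "recursion_value mu ro k d = opt_cost mu k d"
  using assms(2-)
proof (induction k arbitrary: d)
  case 0
  then show ?case by (simp add: recursion_value_zero)
next
  case (Suc k)
  show ?case
  proof (cases "d = 0")
    case True
    then show ?thesis by (simp add: opt_cost_zero recursion_value_def)
  next
    case False
    then have d: "d \<in> {0<..K}" using Suc.prems by auto
    have IH: "recursion_value mu ro k e = opt_cost mu k e" if "e \<in> {0..K}" for e
      using Suc.IH[OF _ that] Suc.prems by auto
    have stage: "stage n K ro (Suc k) d r = trial_cost mu k d r" if "r \<in> {0..1}" for r
    proof -
      have "r * d \<le> 1 * d" using that d by (intro mult_right_mono) auto
      also have "\<dots> \<le> K" using d by simp
      finally have "r * d \<le> K" .
      then show ?thesis
        using that d IH[of "r * d"] by (simp add: stage_eq_recursion_value trial_cost_def assms(1))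
    qed
    have "is_arg_min (stage n K ro (Suc k) d) (\<lambda>r. r \<in> {0..1}) (ro (Suc k) d)"
      using Suc.prems d by auto
    then have am: "is_arg_min (trial_cost mu k d) (\<lambda>r. r \<in> {0..1}) (ro (Suc k) d)"
      using stage by (auto simp: is_arg_min_iff_le)
    then have "stage n K ro (Suc k) d (ro (Suc k) d) = opt_cost mu (Suc k) d"
      using stage[of "ro (Suc k) d"] d is_arg_min_trial_cost_iff[of d mu k "ro (Suc k) d"] by simp
    then show ?thesis by (simp add: recursion_value_Suc assms(1))
  qed
qed

lemma stage_eq_trial_cost:
  assumes "mu = 20 * K\<^sup>2 * (real n - 1)"
    and "\<forall>j\<in>{1..k}. \<forall>d\<in>{0<..K}. is_arg_min (stage n K ro j d) (\<lambda>r. r \<in> {0..1}) (ro j d)"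
    and "d \<in> {0<..K}" "r \<in> {0..1}"
  shows "stage n K ro (Suc k) d r = trial_cost mu k d r"
proof -
  have "r * d \<le> 1 * d" using assms by (intro mult_right_mono) auto
  also have "\<dots> \<le> K" using assms by simp
  finally have "r * d \<le> K" .
  then show ?thesis
    using assms recursion_value_eq_opt_cost[OF assms(1) assms(2), of "r * d"]
    by (simp add: stage_eq_recursion_value trial_cost_def)
qed

lemma is_arg_min_cong_on:
  assumes "\<And>x. P x \<Longrightarrow> f x = g x"
  shows "is_arg_min f P x \<longleftrightarrow> is_arg_min g P x"
  using assms by (auto simp: is_arg_min_def)

lemma arg_min_stage_iff:
  assumes "mu = 20 * K\<^sup>2 * (real n - 1)" "solves_recursion n K m ro" "j \<in> {1..<m}" "d \<in> {0<..K}"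
  shows "is_arg_min (stage n K ro j d) (\<lambda>r. r \<in> {0..1}) r \<longleftrightarrow>
    is_arg_min (trial_cost mu (j - 1) d) (\<lambda>r. r \<in> {0..1}) r"
proof (rule is_arg_min_cong_on)
  fix r :: real assume "r \<in> {0..1}"
  moreover have "\<forall>i\<in>{1..j - 1}. \<forall>d\<in>{0<..K}. is_arg_min (stage n K ro i d) (\<lambda>r. r \<in> {0..1}) (ro i d)"
    using assms by (auto simp: solves_recursion_def)
  ultimately show "stage n K ro j d r = trial_cost mu (j - 1) d r"
    using stage_eq_trial_cost[OF assms(1) _ assms(4), of "j - 1" ro r] assms(3) by auto
qed

text \<open>
  The objective of a stage depends on the ratios of the earlier stages only through their value, so
  the ratios can be chosen as minimizers of \<open>trial_cost\<close>, independently of each other.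
\<close>

lemma solves_recursion_exists: "\<exists>ro. solves_recursion n K m ro"
proof -
  define mu where "mu = 20 * K\<^sup>2 * (real n - 1)"
  define ro where
    "ro j d = (SOME r. is_arg_min (trial_cost mu (j - 1) d) (\<lambda>r. r \<in> {0..1}) r)" for j :: nat and d
  have ro: "is_arg_min (trial_cost mu (j - 1) d) (\<lambda>r. r \<in> {0..1}) (ro j d)" if "0 \<le> d" for j d
    unfolding ro_def
  proof (rule someI_ex)
    show "\<exists>r. is_arg_min (trial_cost mu (j - 1) d) (\<lambda>r. r \<in> {0..1}) r"
      using trial_cost_attains_min[OF that, of mu "j - 1"] unfolding is_arg_min_iff_le by blast
  qed
  have "\<forall>d\<in>{0<..K}. is_arg_min (stage n K ro j d) (\<lambda>r. r \<in> {0..1}) (ro j d)" if "1 \<le> j" for j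
    using that
  proof (induction j rule: less_induct)
    case (less j)
    have lower: "\<forall>i\<in>{1..j - 1}. \<forall>d\<in>{0<..K}.
        is_arg_min (stage n K ro i d) (\<lambda>r. r \<in> {0..1}) (ro i d)"
    proof
      fix i assume "i \<in> {1..j - 1}"
      then show "\<forall>d\<in>{0<..K}. is_arg_min (stage n K ro i d) (\<lambda>r. r \<in> {0..1}) (ro i d)"
        using less.IH[of i] less.prems by auto
    qed
    show ?case
    proof
      fix d assume d: "d \<in> {0<..K}"
      have "stage n K ro j d r = trial_cost mu (j - 1) d r" if "r \<in> {0..1}" for r
        using stage_eq_trial_cost[OF mu_def lower d that] less.prems by simp
      then show "is_arg_min (stage n K ro j d) (\<lambda>r. r \<in> {0..1}) (ro j d)"
        using ro[of d j] d is_arg_min_cong_on[of "\<lambda>r. r \<in> {0..1}" "stage n K ro j d"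
          "trial_cost mu (j - 1) d"] by auto
    qed
  qed
  then have "solves_recursion n K m ro" by (auto simp: solves_recursion_def)
  then show ?thesis by (rule exI[of _ ro])
qed

text \<open>
  The principle of optimality. The sum up to \<open>k + 1\<close> exceeds the value function by the excess of the sum
  up to \<open>k\<close> plus the excess of \<open>trial_cost\<close> over its minimum; both are nonnegative, so equality holds
  iff both vanish.
\<close>

lemma opt_cost_chain:
  fixes d :: "nat \<Rightarrow> real"
  assumes "d 0 = 0" "\<And>j. j \<le> k \<Longrightarrow> d j < d (Suc j)"
  shows "opt_cost mu k (d (Suc k)) \<le> (\<Sum>j\<le>k. cell_cost mu (d j) (d (Suc j)))"
    and "(\<Sum>j\<le>k. cell_cost mu (d j) (d (Suc j))) = opt_cost mu k (d (Suc k)) \<longleftrightarrow>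
      (\<forall>j\<in>{1..k}. is_arg_min (trial_cost mu (j - 1) (d (Suc j))) (\<lambda>r. r \<in> {0..1}) (d j / d (Suc j)))"
proof -
  have "opt_cost mu k (d (Suc k)) \<le> (\<Sum>j\<le>k. cell_cost mu (d j) (d (Suc j))) \<and>
    ((\<Sum>j\<le>k. cell_cost mu (d j) (d (Suc j))) = opt_cost mu k (d (Suc k)) \<longleftrightarrow>
      (\<forall>j\<in>{1..k}. is_arg_min (trial_cost mu (j - 1) (d (Suc j))) (\<lambda>r. r \<in> {0..1}) (d j / d (Suc j))))"
    using assms(2)
  proof (induction k)
    case 0
    then show ?case by (simp add: assms(1))
  next
    case (Suc k)
    have pos: "0 < d (Suc j)" if "j \<le> Suc k" for j
      using that
    proof (induction j)
      case 0 then show ?case using Suc.prems[of 0] assms(1) by simp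
    next
      case (Suc j) then show ?case using Suc.prems \<open>\<And>j. j \<le> Suc k \<Longrightarrow> d j < d (Suc j)\<close>[of "Suc j"] by simp
    qed
    define S where "S = (\<Sum>j\<le>k. cell_cost mu (d j) (d (Suc j)))"
    define e where "e = d (Suc (Suc k))"
    define r where "r = d (Suc k) / e"
    have e: "0 < e" "d (Suc k) < e" "0 < d (Suc k)"
      using pos[of "Suc k"] pos[of k] Suc.prems[of "Suc k"] by (auto simp: e_def)
    then have r: "r \<in> {0..1}" "r * e = d (Suc k)" by (auto simp: r_def)
    have trial: "trial_cost mu k e r = opt_cost mu k (d (Suc k)) + cell_cost mu (d (Suc k)) e"
      by (simp add: trial_cost_def r)
    have IH: "opt_cost mu k (d (Suc k)) \<le> S"
      "S = opt_cost mu k (d (Suc k)) \<longleftrightarrow> (\<forall>j\<in>{1..k}. is_arg_min (trial_cost mu (j - 1) (d (Suc j)))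
          (\<lambda>r. r \<in> {0..1}) (d j / d (Suc j)))"
      using Suc.IH Suc.prems by (auto simp: S_def)
    have le: "opt_cost mu (Suc k) e \<le> trial_cost mu k e r"
      using e r by (intro opt_cost_le_trial) auto
    have sum: "(\<Sum>j\<le>Suc k. cell_cost mu (d j) (d (Suc j))) = S + cell_cost mu (d (Suc k)) e"
      by (simp add: S_def e_def)
    have am: "is_arg_min (trial_cost mu k e) (\<lambda>r. r \<in> {0..1}) r \<longleftrightarrow>
        trial_cost mu k e r = opt_cost mu (Suc k) e"
      using e r is_arg_min_trial_cost_iff[of e mu k r] by simp
    have "{1..Suc k} = insert (Suc k) {1..k}" by auto
    then have split: "(\<forall>j\<in>{1..Suc k}. is_arg_min (trial_cost mu (j - 1) (d (Suc j)))
          (\<lambda>r. r \<in> {0..1}) (d j / d (Suc j))) \<longleftrightarrow>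
        is_arg_min (trial_cost mu k e) (\<lambda>r. r \<in> {0..1}) r \<and> S = opt_cost mu k (d (Suc k))"
      by (simp only: IH ball_simps) (simp add: r_def e_def)
    show ?case
      unfolding split am sum e_def[symmetric] using IH(1) le trial by auto
  qed
  then show "opt_cost mu k (d (Suc k)) \<le> (\<Sum>j\<le>k. cell_cost mu (d j) (d (Suc j)))"
    and "(\<Sum>j\<le>k. cell_cost mu (d j) (d (Suc j))) = opt_cost mu k (d (Suc k)) \<longleftrightarrow>
      (\<forall>j\<in>{1..k}. is_arg_min (trial_cost mu (j - 1) (d (Suc j))) (\<lambda>r. r \<in> {0..1}) (d j / d (Suc j)))"
    by blast+
qed

text \<open>
  The boundaries are constructed from the outermost one inwards, as \<open>r\<^sub>j\<close> depends on \<open>d\<^bsub>j+1\<^esub>\<close>. Interior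
  minimizers make them strictly increasing.
\<close>

lemma opt_cost_attained:
  fixes ro :: "nat \<Rightarrow> real \<Rightarrow> real"
  assumes "0 \<le> mu" "0 < K"
    and ro: "\<And>j d. j \<in> {1..k} \<Longrightarrow> d \<in> {0<..K} \<Longrightarrow>
      is_arg_min (trial_cost mu (j - 1) d) (\<lambda>r. r \<in> {0..1}) (ro j d)"
  shows "\<exists>d. d 0 = 0 \<and> d (Suc k) = K \<and> (\<forall>j\<le>k. d j < d (Suc j)) \<and>
    (\<forall>j\<in>{1..k}. d j = ro j (d (Suc j)) * d (Suc j))"
  using assms(2,3)
proof (induction k arbitrary: K)
  case 0
  then show ?case by (intro exI[of _ "\<lambda>j. if j = 0 then 0 else K"]) auto
next
  case (Suc k)
  define c where "c = ro (Suc k) K * K"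
  have "0 < ro (Suc k) K" "ro (Suc k) K < 1"
    using arg_min_trial_cost_interior[OF assms(1) Suc.prems(1) Suc.prems(2)[of "Suc k" K]] Suc.prems(1)
    by auto
  then have c: "0 < c" "c < K" using Suc.prems(1) by (auto simp: c_def)
  have lower: "is_arg_min (trial_cost mu (j - 1) e) (\<lambda>r. r \<in> {0..1}) (ro j e)"
    if "j \<in> {1..k}" "e \<in> {0<..c}" for j e
    using that c by (intro Suc.prems(2)) auto
  obtain d where d: "d 0 = 0" "d (Suc k) = c" "\<forall>j\<le>k. d j < d (Suc j)"
      "\<forall>j\<in>{1..k}. d j = ro j (d (Suc j)) * d (Suc j)"
    using Suc.IH[OF c(1) lower] by blast
  define d' where "d' = d(Suc (Suc k) := K)"
  have low: "d' j = d j" if "j \<le> Suc k" for j using that by (simp add: d'_def)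
  have top: "d' (Suc (Suc k)) = K" by (simp add: d'_def)
  have incr: "d' j < d' (Suc j)" if "j \<le> Suc k" for j
  proof (cases "j = Suc k")
    case True
    then show ?thesis using low[of "Suc k"] top d(2) c by simp
  next
    case False
    then have "j \<le> k" using that by simp
    then show ?thesis using low[of j] low[of "Suc j"] d(3) by simp
  qed
  have ratio: "d' j = ro j (d' (Suc j)) * d' (Suc j)" if "j \<in> {1..Suc k}" for j
  proof (cases "j = Suc k")
    case True
    then show ?thesis using low[of "Suc k"] top d(2) by (simp add: c_def)
  next
    case False
    then have "j \<in> {1..k}" using that by simp
    then show ?thesis using low[of j] low[of "Suc j"] d(4) by simp
  qed
  have "d' 0 = 0" using low[of 0] d(1) by simp
  then show ?case by (intro exI[of _ d'] conjI allI impI ballI top incr ratio)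
qed

section \<open>Lebesgue measure in coordinates\<close>

lemma measurable_vec_lambda_PiM:
  "(\<lambda>z. \<chi> i. z i) \<in> borel_measurable (Pi\<^sub>M (UNIV :: 'n::finite set) (\<lambda>_. lborel :: real measure))"
proof (subst borel_measurable_euclidean_space, rule ballI)
  fix b :: "real^'n" assume "b \<in> Basis"
  then obtain i where b: "b = axis i 1" by (auto simp: Basis_vec_def)
  show "(\<lambda>z. (\<chi> i. z i) \<bullet> b) \<in> borel_measurable (Pi\<^sub>M (UNIV :: 'n set) (\<lambda>_. lborel :: real measure))"
    by (simp add: b inner_axis)
qed

lemma lborel_vec_eq:
  "(lborel :: (real^'n) measure) = distr (Pi\<^sub>M (UNIV :: 'n::finite set) (\<lambda>_. lborel)) borel (\<lambda>z. \<chi> i. z i)"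
proof (rule lborel_eqI)
  interpret product_sigma_finite "\<lambda>_::'n. lborel :: real measure" by standard
  fix l u :: "real^'n" assume le: "\<And>b. b \<in> Basis \<Longrightarrow> l \<bullet> b \<le> u \<bullet> b"
  have le_nth: "l $ i \<le> u $ i" for i
    using le[OF axis_in_Basis_iff[THEN iffD2], of 1 i] by (simp add: inner_axis)
  have preimage: "(\<lambda>z. \<chi> i. z i) -` box l u \<inter> space (Pi\<^sub>M (UNIV :: 'n set) (\<lambda>_. lborel)) =
      (\<Pi>\<^sub>E i\<in>UNIV. {l $ i<..<u $ i})"
    by (auto simp: mem_box_cart space_PiM PiE_iff)
  have "emeasure (distr (Pi\<^sub>M (UNIV :: 'n set) (\<lambda>_. lborel)) borel (\<lambda>z. \<chi> i. z i)) (box l u) =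
      emeasure (Pi\<^sub>M (UNIV :: 'n set) (\<lambda>_. lborel)) (\<Pi>\<^sub>E i\<in>UNIV. {l $ i<..<u $ i})"
    by (subst emeasure_distr[OF measurable_vec_lambda_PiM]) (auto simp: preimage)
  also have "\<dots> = (\<Prod>i\<in>UNIV. ennreal (u $ i - l $ i))"
    using le_nth by (subst emeasure_PiM) auto
  also have "\<dots> = ennreal (\<Prod>i\<in>UNIV. u $ i - l $ i)"
    using le_nth by (intro prod_ennreal) auto
  also have "(\<Prod>i\<in>UNIV. u $ i - l $ i) = (\<Prod>b\<in>Basis. (u - l) \<bullet> b)"
  proof -
    have range: "(Basis :: (real^'n) set) = (\<lambda>i. axis i 1) ` UNIV"
      by (auto simp: Basis_vec_def)
    show ?thesis
      unfolding range by (subst prod.reindex) (auto simp: inj_on_def axis_eq_axis inner_axis)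
  qed
  finally show "emeasure (distr (Pi\<^sub>M (UNIV :: 'n set) (\<lambda>_. lborel)) borel (\<lambda>z. \<chi> i. z i)) (box l u) =
      ennreal (\<Prod>b\<in>Basis. (u - l) \<bullet> b)" .
qed simp

lemma measurable_insert_coord:
  "(\<lambda>(x, z). insert_coord i1 x z) \<in>
     borel \<Otimes>\<^sub>M Pi\<^sub>M (- {i1}) (\<lambda>_. lborel :: real measure) \<rightarrow>\<^sub>M (borel :: (real^'n::finite) measure)"
proof (subst borel_measurable_euclidean_space, rule ballI)
  fix b :: "real^'n" assume "b \<in> Basis"
  then obtain i where b: "b = axis i 1" by (auto simp: Basis_vec_def)
  show "(\<lambda>p. (case p of (x, z) \<Rightarrow> insert_coord i1 x z) \<bullet> b) \<in>
      borel_measurable (borel \<Otimes>\<^sub>M Pi\<^sub>M (- {i1}) (\<lambda>_. lborel :: real measure))"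
    by (cases "i = i1") (auto simp: b inner_axis insert_coord_def case_prod_beta)
qed

text \<open>
  Integrating out all coordinates except one, in the form in which the marginal density and \<open>\<sigma>\<^sup>2\<close> are
  defined.
\<close>

lemma lborel_vec_fubini:
  fixes F :: "real^'n::finite \<Rightarrow> real"
  assumes int: "integrable lborel F"
  shows "(\<integral>v. F v \<partial>lborel) =
    (\<integral>x. (\<integral>z. F (insert_coord i1 x z) \<partial>Pi\<^sub>M (- {i1}) (\<lambda>_. lborel)) \<partial>lborel)"
proof -
  interpret product_sigma_finite "\<lambda>_::'n. lborel :: real measure" by standard
  interpret rest: finite_product_sigma_finite "\<lambda>_::'n. lborel :: real measure" "- {i1}"
    by standard simp
  have F [measurable]: "F \<in> borel_measurable borel" using int by auto
  have UNIV: "(UNIV :: 'n set) = {i1} \<union> - {i1}" by auto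
  have int': "integrable (Pi\<^sub>M UNIV (\<lambda>_::'n. lborel)) (\<lambda>z. F (\<chi> i. z i))"
    using int unfolding lborel_vec_eq by (subst (asm) integrable_distr_eq[OF measurable_vec_lambda_PiM]) auto
  have "(\<integral>v. F v \<partial>lborel) = (\<integral>z. F (\<chi> i. z i) \<partial>Pi\<^sub>M UNIV (\<lambda>_::'n. lborel))"
    unfolding lborel_vec_eq by (subst integral_distr[OF measurable_vec_lambda_PiM]) auto
  also have "\<dots> = (\<integral>x. (\<integral>y. F (\<chi> i. merge {i1} (- {i1}) (x, y) i) \<partial>Pi\<^sub>M (- {i1}) (\<lambda>_. lborel))
      \<partial>Pi\<^sub>M {i1} (\<lambda>_. lborel))"
    using product_integral_fold[of "{i1}" "- {i1}" "\<lambda>z. F (\<chi> i. z i)"] int' unfolding UNIV by simp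
  also have "\<dots> = (\<integral>x. (\<integral>z. F (insert_coord i1 (x i1) z) \<partial>Pi\<^sub>M (- {i1}) (\<lambda>_. lborel))
      \<partial>Pi\<^sub>M {i1} (\<lambda>_. lborel))"
    by (intro Bochner_Integration.integral_cong refl arg_cong[where f = F])
      (auto simp: insert_coord_def merge_def vec_eq_iff)
  also have "\<dots> = (\<integral>x. (\<integral>z. F (insert_coord i1 x z) \<partial>Pi\<^sub>M (- {i1}) (\<lambda>_. lborel)) \<partial>lborel)"
  proof (rule product_integral_singleton)
    have "(\<lambda>p. F ((\<lambda>(x, z). insert_coord i1 x z) p)) \<in>
        borel_measurable (borel \<Otimes>\<^sub>M Pi\<^sub>M (- {i1}) (\<lambda>_. lborel))"
      by (rule measurable_compose[OF measurable_insert_coord F])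
    then have "(\<lambda>x. \<integral>z. F (insert_coord i1 x z) \<partial>Pi\<^sub>M (- {i1}) (\<lambda>_. lborel)) \<in> borel_measurable borel"
      by (intro rest.borel_measurable_lebesgue_integral) (simp add: case_prod_beta)
    then show "(\<lambda>x. \<integral>z. F (insert_coord i1 x z) \<partial>Pi\<^sub>M (- {i1}) (\<lambda>_. lborel)) \<in> borel_measurable lborel"
      by simp
  qed
  finally show ?thesis .
qed

section \<open>Moments of the uniform density\<close>

lemma lborel_integral_indicator_FTC:
  fixes F f :: "real \<Rightarrow> real"
  assumes "a \<le> b" "\<And>x. (F has_real_derivative f x) (at x)" "\<And>x. isCont f x"
  shows "(\<integral>x. indicator {a..b} x * f x \<partial>lborel) = F b - F a"
    and "integrable lborel (\<lambda>x. indicator {a..b} x * f x)"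
proof -
  show "(\<integral>x. indicator {a..b} x * f x \<partial>lborel) = F b - F a"
    using integral_FTC_Icc_real[of a b F f] assms by (simp add: mult.commute)
  have "continuous_on {a..b} f" using assms(3) by (simp add: continuous_at_imp_continuous_on)
  then show "integrable lborel (\<lambda>x. indicator {a..b} x * f x)"
    using borel_integrable_atLeastAtMost[of a b f] assms(3)
    by (simp add: mult.commute indicator_def if_distrib cong: if_cong)
qed

lemma interval_moment:
  assumes "kappa > 0"
  shows "(\<integral>y. indicator {- kappa..kappa} y / (2 * kappa) * y ^ p \<partial>lborel) =
      (kappa ^ Suc p - (- kappa) ^ Suc p) / (2 * kappa * real (Suc p))"
    and "integrable lborel (\<lambda>y. indicator {- kappa..kappa} y / (2 * kappa) * y ^ p)"
proof -
  have D: "((\<lambda>y. y ^ Suc p / (2 * kappa * real (Suc p))) has_real_derivative y ^ p / (2 * kappa)) (at y)" for y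
    using DERIV_cdivide[OF DERIV_pow[of "Suc p" y], of "2 * kappa * real (Suc p)"]
    by (simp del: of_nat_Suc power_Suc)
  have eq: "(\<lambda>y. indicator {- kappa..kappa} y / (2 * kappa) * y ^ p) =
      (\<lambda>y. indicator {- kappa..kappa} y * (y ^ p / (2 * kappa)))" by auto
  show "(\<integral>y. indicator {- kappa..kappa} y / (2 * kappa) * y ^ p \<partial>lborel) =
      (kappa ^ Suc p - (- kappa) ^ Suc p) / (2 * kappa * real (Suc p))"
    unfolding eq using lborel_integral_indicator_FTC(1)[OF _ D, of "- kappa" kappa] assms
    by (simp add: diff_divide_distrib del: power_Suc of_nat_Suc)
  show "integrable lborel (\<lambda>y. indicator {- kappa..kappa} y / (2 * kappa) * y ^ p)"
    unfolding eq using assms by (intro lborel_integral_indicator_FTC(2)[OF _ D]) auto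
qed

lemma uniform_density_insert_coord:
  "uniform_density kappa (insert_coord i1 x z :: real^'n::finite) =
    indicator {- kappa..kappa} x / (2 * kappa) * (\<Prod>i\<in>- {i1}. indicator {- kappa..kappa} (z i) / (2 * kappa))"
proof -
  define c where "c i = (insert_coord i1 x z :: real^'n) $ i" for i
  have "(\<Prod>i\<in>UNIV. indicator {- kappa..kappa} (c i) / (2 * kappa) :: real) =
      indicator {- kappa..kappa} (c i1) / (2 * kappa) * (\<Prod>i\<in>- {i1}. indicator {- kappa..kappa} (c i) / (2 * kappa))"
    by (simp add: prod.remove[of UNIV i1] Compl_eq_Diff_UNIV)
  also have "\<dots> = indicator {- kappa..kappa} x / (2 * kappa) * (\<Prod>i\<in>- {i1}. indicator {- kappa..kappa} (z i) / (2 * kappa))"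
    by (auto simp: c_def insert_coord_def intro!: prod.cong)
  also have "(\<Prod>i\<in>UNIV. indicator {- kappa..kappa} (c i) / (2 * kappa) :: real) =
      (\<Prod>i\<in>UNIV. indicator {- kappa..kappa} (c i)) / (2 * kappa) ^ CARD('n)"
    by (simp add: prod_dividef)
  also have "(\<Prod>i\<in>UNIV. indicator {- kappa..kappa} (c i) :: real) =
      (if \<forall>i. c i \<in> {- kappa..kappa} then 1 else 0)"
    by (auto simp: indicator_def)
  also have "\<dots> / (2 * kappa) ^ CARD('n) = uniform_density kappa (insert_coord i1 x z :: real^'n)"
    by (simp add: uniform_density_def c_def)
  finally show ?thesis .
qed

text \<open>
  The exponent \<open>p = 0\<close> gives the marginal density, \<open>p = 1\<close> the vanishing of the mean and \<open>p = 2\<close> the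
  variance. For \<open>p = 0\<close> also \<open>k = i1\<close> is admitted, as dimension one has no other coordinate.
\<close>

lemma uniform_density_section_moment:
  fixes k i1 :: "'n::finite"
  assumes "kappa > 0" and k: "k \<noteq> i1 \<or> p = 0"
  shows "(\<integral>z. z k ^ p * uniform_density kappa (insert_coord i1 x z) \<partial>Pi\<^sub>M (- {i1}) (\<lambda>_. lborel)) =
      indicator {- kappa..kappa} x / (2 * kappa) * ((kappa ^ Suc p - (- kappa) ^ Suc p) / (2 * kappa * real (Suc p)))"
    and "integrable (Pi\<^sub>M (- {i1}) (\<lambda>_. lborel)) (\<lambda>z. z k ^ p * uniform_density kappa (insert_coord i1 x z))"
proof -
  interpret product_sigma_finite "\<lambda>_::'n. lborel :: real measure" by standard
  \<comment> \<open>the monomial is written as a product over all remaining coordinates, so that the integral factors\<close>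
  define e where "e i = (if i = k then p else 0)" for i
  define mom where "mom p = (kappa ^ Suc p - (- kappa) ^ Suc p) / (2 * kappa * real (Suc p))" for p
  have mom0: "mom 0 = 1" using assms by (simp add: mom_def)
  have delta: "(\<Prod>i\<in>- {i1}. if i = k then a i else 1) = a k" if "k = i1 \<Longrightarrow> a k = 1" for a :: "'n \<Rightarrow> real"
    using that by (subst prod.delta) auto
  have monomial: "(\<Prod>i\<in>- {i1}. z i ^ e i) = z k ^ p" for z :: "'n \<Rightarrow> real"
    using delta[of "\<lambda>i. z i ^ p"] k by (auto simp: e_def if_distrib cong: if_cong)
  have moments: "(\<Prod>i\<in>- {i1}. mom (e i)) = mom p"
    using delta[of "\<lambda>i. mom p"] k mom0 by (auto simp: e_def if_distrib[of mom] cong: if_cong)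
  have eq: "z k ^ p * uniform_density kappa (insert_coord i1 x z) = indicator {- kappa..kappa} x / (2 * kappa) *
      (\<Prod>i\<in>- {i1}. indicator {- kappa..kappa} (z i) / (2 * kappa) * z i ^ e i)" for z
    unfolding uniform_density_insert_coord prod.distrib monomial by simp
  show "(\<integral>z. z k ^ p * uniform_density kappa (insert_coord i1 x z) \<partial>Pi\<^sub>M (- {i1}) (\<lambda>_. lborel)) =
      indicator {- kappa..kappa} x / (2 * kappa) * ((kappa ^ Suc p - (- kappa) ^ Suc p) / (2 * kappa * real (Suc p)))"
    unfolding eq integral_mult_right_zero
    by (subst product_integral_prod)
      (auto simp only: interval_moment[OF assms(1)] mom_def[symmetric] moments finite)
  show "integrable (Pi\<^sub>M (- {i1}) (\<lambda>_. lborel)) (\<lambda>z. z k ^ p * uniform_density kappa (insert_coord i1 x z))"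
    unfolding eq
    by (intro integrable_mult_right product_integrable_prod interval_moment(2)[OF assms(1)] finite)
qed

lemma marginal_uniform:
  assumes "kappa > 0"
  shows "marginal (i1 :: 'n::finite) (uniform_density kappa) x = indicator {- kappa..kappa} x / (2 * kappa)"
  using uniform_density_section_moment(1)[OF assms, of i1 i1 0 x] assms by (simp add: marginal_def)

text \<open>
  Given the first coordinate \<open>x\<close>, each of the other \<open>n - 1\<close> coordinates has second moment \<open>kappa\<^sup>2 / 3\<close>.
\<close>

lemma section_second_moment_uniform:
  fixes i1 :: "'n::finite"
  assumes "kappa > 0"
  shows "(\<integral>z. (\<Sum>k\<in>UNIV. (insert_coord i1 x z $ k)\<^sup>2) * uniform_density kappa (insert_coord i1 x z)
        \<partial>(Pi\<^sub>M (- {i1}) (\<lambda>_. lborel))) =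
      (x\<^sup>2 + (real CARD('n) - 1) * kappa\<^sup>2 / 3) * marginal i1 (uniform_density kappa) x"
proof -
  let ?M = "Pi\<^sub>M (- {i1}) (\<lambda>_. lborel :: real measure)"
  let ?u = "\<lambda>z. uniform_density kappa (insert_coord i1 x z)"
  have split: "(\<Sum>k\<in>UNIV. (insert_coord i1 x z $ k)\<^sup>2) * ?u z =
      x\<^sup>2 * (z i1 ^ 0 * ?u z) + (\<Sum>k\<in>- {i1}. z k ^ 2 * ?u z)" for z
  proof -
    have "(\<Sum>k\<in>UNIV. (insert_coord i1 x z $ k)\<^sup>2) = x\<^sup>2 + (\<Sum>k\<in>- {i1}. (z k)\<^sup>2)"
      by (subst sum.remove[of UNIV i1]) (auto simp: insert_coord_def Compl_eq_Diff_UNIV intro!: sum.cong)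
    then show ?thesis by (simp add: distrib_right sum_distrib_right)
  qed
  have int0: "integrable ?M (\<lambda>z. z i1 ^ 0 * ?u z)"
    using uniform_density_section_moment(2)[OF assms] by blast
  have int2: "integrable ?M (\<lambda>z. z k ^ 2 * ?u z)" if "k \<in> - {i1}" for k
    using uniform_density_section_moment(2)[OF assms] that by blast
  have mom2: "(\<integral>z. z k ^ 2 * ?u z \<partial>?M) = kappa\<^sup>2 / 3 * marginal i1 (uniform_density kappa) x" if "k \<in> - {i1}" for k
    using uniform_density_section_moment(1)[OF assms, of k i1 2 x] that assms
    by (simp add: marginal_uniform field_simps eval_nat_numeral)
  have mom0: "(\<integral>z. z i1 ^ 0 * ?u z \<partial>?M) = marginal i1 (uniform_density kappa) x"
    by (simp add: marginal_def)
  have "(\<integral>z. (\<Sum>k\<in>UNIV. (insert_coord i1 x z $ k)\<^sup>2) * ?u z \<partial>?M) =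
      x\<^sup>2 * marginal i1 (uniform_density kappa) x
      + (\<Sum>k\<in>- {i1}. kappa\<^sup>2 / 3 * marginal i1 (uniform_density kappa) x)"
  proof -
    have "integrable ?M (\<lambda>z. x\<^sup>2 * (z i1 ^ 0 * ?u z))"
      using int0 by (rule integrable_mult_right)
    moreover have "integrable ?M (\<lambda>z. \<Sum>k\<in>- {i1}. z k ^ 2 * ?u z)"
      using int2 by (rule Bochner_Integration.integrable_sum)
    ultimately have "(\<integral>z. (\<Sum>k\<in>UNIV. (insert_coord i1 x z $ k)\<^sup>2) * ?u z \<partial>?M) =
        x\<^sup>2 * (\<integral>z. z i1 ^ 0 * ?u z \<partial>?M) + (\<Sum>k\<in>- {i1}. \<integral>z. z k ^ 2 * ?u z \<partial>?M)"
      unfolding split using int2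
      by (simp only: Bochner_Integration.integral_add Bochner_Integration.integral_sum integral_mult_right_zero)
    also have "\<dots> = x\<^sup>2 * marginal i1 (uniform_density kappa) x
        + (\<Sum>k\<in>- {i1}. kappa\<^sup>2 / 3 * marginal i1 (uniform_density kappa) x)"
      unfolding mom0 by (simp only: mom2 cong: sum.cong)
    finally show ?thesis .
  qed
  also have "\<dots> = (x\<^sup>2 + (real CARD('n) - 1) * kappa\<^sup>2 / 3) * marginal i1 (uniform_density kappa) x"
    by (simp add: Compl_eq_Diff_UNIV card_Diff_singleton of_nat_diff Suc_leI field_simps)
  finally show ?thesis .
qed

text \<open>
  The product has no singularity: where the marginal density vanishes, so does the integral that \<open>\<sigma>\<^sup>2\<close>
  normalizes.
\<close>

lemma sigma2_times_marginal:
  fixes i1 :: "'n::finite"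
  assumes "kappa > 0"
  shows "sigma2 i1 (uniform_density kappa) x * marginal i1 (uniform_density kappa) x =
      (\<integral>z. (\<Sum>k\<in>UNIV. (insert_coord i1 x z $ k)\<^sup>2) * uniform_density kappa (insert_coord i1 x z)
        \<partial>(Pi\<^sub>M (- {i1}) (\<lambda>_. lborel)))"
  unfolding sigma2_def section_second_moment_uniform[OF assms]
  by (cases "marginal i1 (uniform_density kappa) x = 0") auto

lemma sigma2_marginal_uniform:
  fixes i1 :: "'n::finite"
  assumes "kappa > 0"
  shows "sigma2 i1 (uniform_density kappa) x * marginal i1 (uniform_density kappa) x =
      (x\<^sup>2 + (real CARD('n) - 1) * kappa\<^sup>2 / 3) * (indicator {- kappa..kappa} x / (2 * kappa))"
  unfolding sigma2_times_marginal[OF assms] section_second_moment_uniform[OF assms]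
  by (simp only: marginal_uniform[OF assms])


section \<open>The cost as a one-dimensional integral\<close>

lemma (in prob_space) AE_uniform_in_cube:
  fixes X :: "'a \<Rightarrow> real^'n::finite"
  assumes "distributed M lborel X (\<lambda>v. ennreal (uniform_density kappa v))"
  shows "AE w in M. \<forall>k. X w $ k \<in> {- kappa..kappa}"
proof -
  have "AE v in lborel. 0 < ennreal (uniform_density kappa v) \<longrightarrow> (\<forall>k. v $ k \<in> {- kappa..kappa})"
    by (auto simp: uniform_density_def)
  moreover have "Measurable.pred lborel (\<lambda>v::real^'n. \<forall>k. v $ k \<in> {- kappa..kappa})"
    by measurable
  ultimately show ?thesis by (subst distributed_AE2[OF assms])
qed

lemma uniform_density_nonneg: "0 \<le> kappa \<Longrightarrow> 0 \<le> uniform_density kappa v"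
  by (simp add: uniform_density_def)

lemma expectation_uniform_section:
  fixes X :: "'w \<Rightarrow> real^'n::finite"
  assumes "0 \<le> kappa" and X: "distributed P lborel X (\<lambda>v. ennreal (uniform_density kappa v))"
    and G: "G \<in> borel_measurable borel" "integrable P (\<lambda>w. G (X w))"
  shows "(\<integral>w. G (X w) \<partial>P) =
    (\<integral>x. (\<integral>z. uniform_density kappa (insert_coord i1 x z) * G (insert_coord i1 x z)
      \<partial>Pi\<^sub>M (- {i1}) (\<lambda>_. lborel)) \<partial>lborel)"
proof -
  have "(\<integral>w. G (X w) \<partial>P) = (\<integral>v. uniform_density kappa v * G v \<partial>lborel)"
    using distributed_integral[OF X, of G] G assms(1) by (simp add: uniform_density_nonneg)
  also have "integrable lborel (\<lambda>v. uniform_density kappa v * G v)"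
    using distributed_integrable[OF X, of G] G assms(1) by (simp add: uniform_density_nonneg)
  note lborel_vec_fubini[OF this, of i1]
  finally show ?thesis .
qed

lemma (in prob_space) integrable_AE_bounded:
  fixes f :: "'a \<Rightarrow> real"
  assumes "f \<in> borel_measurable M" "AE w in M. \<bar>f w\<bar> \<le> B"
  shows "integrable M f"
  using assms by (intro integrable_const_bound[where B = B]) auto

lemma (in prob_space) weighted_regressor_integrable:
  fixes X :: "'a \<Rightarrow> real^'n::finite"
  assumes X: "distributed M lborel X (\<lambda>v. ennreal (uniform_density kappa v))"
    and g: "g \<in> borel_measurable borel" "\<And>x. \<bar>g x\<bar> \<le> B"
  shows "AE w in M. \<bar>X w $ k * g (X w $ i1)\<bar> \<le> kappa * B"
    and "(\<lambda>w. X w $ k * g (X w $ i1)) \<in> borel_measurable M"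
proof -
  show "AE w in M. \<bar>X w $ k * g (X w $ i1)\<bar> \<le> kappa * B"
    using AE_uniform_in_cube[OF X]
  proof eventually_elim
    case (elim w)
    then have "\<bar>X w $ k\<bar> \<le> kappa" by (simp add: abs_le_iff minus_le_iff)
    then show ?case using g(2)[of "X w $ i1"] by (simp add: abs_mult mult_mono')
  qed
  have "X \<in> borel_measurable M" using X by (simp add: distributed_def)
  then have nth [measurable]: "(\<lambda>w. X w $ i) \<in> borel_measurable M" for i
    by (rule measurable_compose) measurable
  have [measurable]: "(\<lambda>w. g (X w $ i1)) \<in> borel_measurable M"
    by (rule measurable_compose[OF nth g(1)])
  show "(\<lambda>w. X w $ k * g (X w $ i1)) \<in> borel_measurable M" by measurable
qed

text \<open>
  A coordinate \<open>k \<noteq> i1\<close> has mean zero given the coordinate \<open>i1\<close>, so the first moment survives only for \<open>k = i1\<close>.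
\<close>

lemma (in prob_space) weighted_regressor_moments:
  fixes X :: "'a \<Rightarrow> real^'n::finite"
  assumes kappa: "kappa > 0"
    and X: "distributed M lborel X (\<lambda>v. ennreal (uniform_density kappa v))"
    and g: "g \<in> borel_measurable borel" "\<And>x. \<bar>g x\<bar> \<le> B"
  shows "(\<integral>w. X w $ k * g (X w $ i1) \<partial>M) =
      (if k = i1 then \<integral>x. x * g x * marginal i1 (uniform_density kappa) x \<partial>lborel else 0)"
    and "(\<Sum>k\<in>UNIV. \<integral>w. (X w $ k * g (X w $ i1))\<^sup>2 \<partial>M) =
      (\<integral>x. sigma2 i1 (uniform_density kappa) x * (g x)\<^sup>2 * marginal i1 (uniform_density kappa) x \<partial>lborel)"
proof -
  note [measurable] = g(1)
  have ins: "insert_coord i1 x z $ i1 = x" "k \<noteq> i1 \<Longrightarrow> insert_coord i1 x z $ k = z k" for x z k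
    by (auto simp: insert_coord_def)
  note bounded = weighted_regressor_integrable[OF X g]
  have int1: "integrable M (\<lambda>w. X w $ k * g (X w $ i1))" for k
    using integrable_AE_bounded bounded by blast
  have int2: "integrable M (\<lambda>w. (X w $ k * g (X w $ i1))\<^sup>2)" for k
  proof (rule integrable_AE_bounded)
    show "(\<lambda>w. (X w $ k * g (X w $ i1))\<^sup>2) \<in> borel_measurable M"
      using bounded(2) by (rule borel_measurable_power)
    show "AE w in M. \<bar>(X w $ k * g (X w $ i1))\<^sup>2\<bar> \<le> (kappa * B)\<^sup>2"
      using bounded(1)[of k i1] by eventually_elim (simp add: abs_le_square_iff[symmetric])
  qed
  have "(\<integral>w. X w $ k * g (X w $ i1) \<partial>M) =
      (\<integral>x. (\<integral>z. uniform_density kappa (insert_coord i1 x z) *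
        (insert_coord i1 x z $ k * g (insert_coord i1 x z $ i1)) \<partial>Pi\<^sub>M (- {i1}) (\<lambda>_. lborel)) \<partial>lborel)"
    using expectation_uniform_section[OF _ X, of "\<lambda>v. v $ k * g (v $ i1)" i1] kappa int1 by simp
  also have "\<dots> = (if k = i1 then \<integral>x. x * g x * marginal i1 (uniform_density kappa) x \<partial>lborel else 0)"
  proof (cases "k = i1")
    case True
    then show ?thesis
      by (simp add: ins marginal_def mult.commute[of "uniform_density _ _"])
  next
    case False
    have "(\<integral>z. uniform_density kappa (insert_coord i1 x z) *
        (insert_coord i1 x z $ k * g (insert_coord i1 x z $ i1)) \<partial>Pi\<^sub>M (- {i1}) (\<lambda>_. lborel)) = 0" for x
    proof -
      have "(\<integral>z. uniform_density kappa (insert_coord i1 x z) *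
          (insert_coord i1 x z $ k * g (insert_coord i1 x z $ i1)) \<partial>Pi\<^sub>M (- {i1}) (\<lambda>_. lborel)) =
          (\<integral>z. g x * (z k ^ 1 * uniform_density kappa (insert_coord i1 x z)) \<partial>Pi\<^sub>M (- {i1}) (\<lambda>_. lborel))"
        using False by (simp add: ins mult_ac)
      also have "\<dots> = 0"
        unfolding integral_mult_right_zero
        using uniform_density_section_moment(1)[OF kappa, of k i1 1 x] False by simp
      finally show ?thesis .
    qed
    then show ?thesis using False by simp
  qed
  finally show "(\<integral>w. X w $ k * g (X w $ i1) \<partial>M) =
      (if k = i1 then \<integral>x. x * g x * marginal i1 (uniform_density kappa) x \<partial>lborel else 0)" .
  have "(\<Sum>k\<in>UNIV. \<integral>w. (X w $ k * g (X w $ i1))\<^sup>2 \<partial>M) =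
      (\<integral>w. (\<Sum>k\<in>UNIV. (X w $ k * g (X w $ i1))\<^sup>2) \<partial>M)"
    using int2 by simp
  also have "\<dots> = (\<integral>x. (\<integral>z. uniform_density kappa (insert_coord i1 x z) *
        (\<Sum>k\<in>UNIV. (insert_coord i1 x z $ k * g (insert_coord i1 x z $ i1))\<^sup>2) \<partial>Pi\<^sub>M (- {i1}) (\<lambda>_. lborel)) \<partial>lborel)"
    using expectation_uniform_section[OF _ X, of "\<lambda>v. \<Sum>k\<in>UNIV. (v $ k * g (v $ i1))\<^sup>2" i1] kappa int2
    by simp
  also have "\<dots> = (\<integral>x. (\<integral>z. (g x)\<^sup>2 * ((\<Sum>k\<in>UNIV. (insert_coord i1 x z $ k)\<^sup>2) *
      uniform_density kappa (insert_coord i1 x z)) \<partial>Pi\<^sub>M (- {i1}) (\<lambda>_. lborel)) \<partial>lborel)"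
    by (simp add: ins power_mult_distrib sum_distrib_left sum_distrib_right mult_ac)
  also have "\<dots> = (\<integral>x. (g x)\<^sup>2 * (sigma2 i1 (uniform_density kappa) x * marginal i1 (uniform_density kappa) x) \<partial>lborel)"
    unfolding integral_mult_right_zero sigma2_times_marginal[OF kappa] ..
  also have "\<dots> = (\<integral>x. sigma2 i1 (uniform_density kappa) x * (g x)\<^sup>2 * marginal i1 (uniform_density kappa) x \<partial>lborel)"
    by (simp add: mult_ac)
  finally show "(\<Sum>k\<in>UNIV. \<integral>w. (X w $ k * g (X w $ i1))\<^sup>2 \<partial>M) =
      (\<integral>x. sigma2 i1 (uniform_density kappa) x * (g x)\<^sup>2 * marginal i1 (uniform_density kappa) x \<partial>lborel)" .
qed

text \<open>
  The products of terms at different times have expectation zero: uncorrelatedness factors it into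
  two means, which vanish by symmetry for \<open>k \<noteq> i1\<close> and by \<open>mean\<close> for \<open>k = i1\<close>. What is left is one and the
  same second moment for each time.
\<close>

lemma (in prob_space) cost_of_time_sum:
  fixes X :: "'N::finite \<Rightarrow> 'a \<Rightarrow> real^'n::finite"
  assumes kappa: "kappa > 0"
    and X: "\<And>t. distributed M lborel (X t) (\<lambda>v. ennreal (uniform_density kappa v))"
    and uncorr: "uncorrelated_in_time M i1 X"
    and e: "e \<in> borel_measurable borel" "\<And>x. x \<in> {- kappa..kappa} \<Longrightarrow> \<bar>e x\<bar> \<le> B"
    and mean: "(\<integral>x. x * e x * marginal i1 (uniform_density kappa) x \<partial>lborel) = 0"
  shows "(\<Sum>k\<in>UNIV. \<integral>w. (\<Sum>t\<in>UNIV. X t w $ k * e (X t w $ i1))\<^sup>2 \<partial>M) =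
      real CARD('N) * (\<integral>x. sigma2 i1 (uniform_density kappa) x * (e x)\<^sup>2 * marginal i1 (uniform_density kappa) x \<partial>lborel)"
    and "integrable M (\<lambda>w. (\<Sum>t\<in>UNIV. X t w $ k * e (X t w $ i1))\<^sup>2)"
proof -
  \<comment> \<open>uncorrelatedness is available for bounded functions, and \<open>e\<close> is bounded on the support only\<close>
  define g where "g x = (if x \<in> {- kappa..kappa} then e x else 0)" for x
  have g: "g \<in> borel_measurable borel" using e(1) unfolding g_def by measurable
  have gB: "\<bar>g x\<bar> \<le> B" for x
    using e(2)[of x] e(2)[of 0] kappa by (auto simp: g_def)
  have marg0: "marginal i1 (uniform_density kappa) x = 0" if "x \<notin> {- kappa..kappa}" for x
    using that kappa by (simp add: marginal_uniform)
  define Z where "Z k t w = X t w $ k * g (X t w $ i1)" for k t w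
  have X_meas: "X t \<in> borel_measurable M" for t using X by (simp add: distributed_def)
  have eZ: "AE w in M. \<forall>t k. X t w $ k * e (X t w $ i1) = Z k t w"
  proof -
    have "AE w in M. \<forall>t. \<forall>k. X t w $ k \<in> {- kappa..kappa}"
      using AE_uniform_in_cube[OF X] by (simp add: AE_all_countable)
    then show ?thesis by eventually_elim (simp add: Z_def g_def)
  qed
  have Z_meas [measurable]: "Z k t \<in> borel_measurable M" for k t
    unfolding Z_def by (rule weighted_regressor_integrable(2)[OF X g gB])
  have Z_bound: "AE w in M. \<bar>Z k t w\<bar> \<le> kappa * B" for k t
    unfolding Z_def by (rule weighted_regressor_integrable(1)[OF X g gB])
  have ZZ_int: "integrable M (\<lambda>w. Z k s w * Z k t w)" for k s t
  proof (rule integrable_AE_bounded)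
    show "AE w in M. \<bar>Z k s w * Z k t w\<bar> \<le> (kappa * B) * (kappa * B)"
      using Z_bound[of k s] Z_bound[of k t] by eventually_elim (simp add: abs_mult mult_mono')
  qed measurable
  have cross: "(\<integral>w. Z k s w * Z k t w \<partial>M) = 0" if "s \<noteq> t" for k s t
  proof -
    have "bounded (range g)" using gB by (auto simp: bounded_iff)
    then have "(\<integral>w. Z k s w * Z k t w \<partial>M) = (\<integral>w. Z k s w \<partial>M) * (\<integral>w. Z k t w \<partial>M)"
      using uncorr g that unfolding uncorrelated_in_time_def Z_def by blast
    also have "(\<integral>w. Z k s w \<partial>M) = 0"
    proof -
      have "(\<integral>x. x * g x * marginal i1 (uniform_density kappa) x \<partial>lborel) =
          (\<integral>x. x * e x * marginal i1 (uniform_density kappa) x \<partial>lborel)"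
        using marg0 by (intro Bochner_Integration.integral_cong) (auto simp: g_def)
      then show ?thesis
        unfolding Z_def weighted_regressor_moments(1)[OF kappa X g gB] by (simp add: mean)
    qed
    finally show ?thesis by simp
  qed
  have sq: "(\<Sum>t\<in>UNIV. Z k t w)\<^sup>2 = (\<Sum>s\<in>UNIV. \<Sum>t\<in>UNIV. Z k s w * Z k t w)" for k w
    by (simp add: power2_eq_square sum_product)
  have meas_e: "(\<lambda>w. (\<Sum>t\<in>UNIV. X t w $ k * e (X t w $ i1))\<^sup>2) \<in> borel_measurable M" for k
  proof -
    have nth [measurable]: "(\<lambda>w. X t w $ i) \<in> borel_measurable M" for t i
      using X_meas by (rule measurable_compose) measurable
    have [measurable]: "(\<lambda>w. e (X t w $ i1)) \<in> borel_measurable M" for t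
      by (rule measurable_compose[OF nth e(1)])
    show ?thesis by measurable
  qed
  have AE_sq: "AE w in M. (\<Sum>t\<in>UNIV. X t w $ k * e (X t w $ i1))\<^sup>2 = (\<Sum>t\<in>UNIV. Z k t w)\<^sup>2" for k
    using eZ by eventually_elim simp
  have int_sq: "integrable M (\<lambda>w. (\<Sum>t\<in>UNIV. Z k t w)\<^sup>2)" for k
    unfolding sq by (intro Bochner_Integration.integrable_sum ZZ_int)
  show "integrable M (\<lambda>w. (\<Sum>t\<in>UNIV. X t w $ k * e (X t w $ i1))\<^sup>2)"
    using integrable_cong_AE[OF meas_e _ AE_sq] int_sq by auto
  have "(\<integral>w. (\<Sum>t\<in>UNIV. X t w $ k * e (X t w $ i1))\<^sup>2 \<partial>M) = (\<Sum>t\<in>UNIV. \<integral>w. (Z k t w)\<^sup>2 \<partial>M)" for k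
  proof -
    have "(\<integral>w. (\<Sum>t\<in>UNIV. X t w $ k * e (X t w $ i1))\<^sup>2 \<partial>M) = (\<integral>w. (\<Sum>t\<in>UNIV. Z k t w)\<^sup>2 \<partial>M)"
      by (rule integral_cong_AE[OF meas_e _ AE_sq]) measurable
    also have "\<dots> = (\<Sum>s\<in>UNIV. \<Sum>t\<in>UNIV. \<integral>w. Z k s w * Z k t w \<partial>M)"
      unfolding sq using ZZ_int by simp
    also have "\<dots> = (\<Sum>s\<in>UNIV. \<Sum>t\<in>UNIV. if t = s then \<integral>w. (Z k s w)\<^sup>2 \<partial>M else 0)"
      using cross by (intro sum.cong refl) (auto simp: power2_eq_square)
    finally show ?thesis by simp
  qed
  then have "(\<Sum>k\<in>UNIV. \<integral>w. (\<Sum>t\<in>UNIV. X t w $ k * e (X t w $ i1))\<^sup>2 \<partial>M) =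
      (\<Sum>t\<in>UNIV. \<Sum>k\<in>UNIV. \<integral>w. (Z k t w)\<^sup>2 \<partial>M)"
    by (simp add: sum.swap[of _ "UNIV :: 'N set"])
  also have "\<dots> = real CARD('N) * (\<integral>x. sigma2 i1 (uniform_density kappa) x * (g x)\<^sup>2 * marginal i1 (uniform_density kappa) x \<partial>lborel)"
    unfolding Z_def weighted_regressor_moments(2)[OF kappa X g gB] by simp
  also have "(\<integral>x. sigma2 i1 (uniform_density kappa) x * (g x)\<^sup>2 * marginal i1 (uniform_density kappa) x \<partial>lborel) =
      (\<integral>x. sigma2 i1 (uniform_density kappa) x * (e x)\<^sup>2 * marginal i1 (uniform_density kappa) x \<partial>lborel)"
    using marg0 by (intro Bochner_Integration.integral_cong) (auto simp: g_def)
  finally show "(\<Sum>k\<in>UNIV. \<integral>w. (\<Sum>t\<in>UNIV. X t w $ k * e (X t w $ i1))\<^sup>2 \<partial>M) =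
      real CARD('N) * (\<integral>x. sigma2 i1 (uniform_density kappa) x * (e x)\<^sup>2 * marginal i1 (uniform_density kappa) x \<partial>lborel)" .
qed

lemma orthogonal_matrix_rotated_norm:
  fixes T :: "real^'n^'n"
  assumes "orthogonal_matrix T"
  shows "norm (transpose T *v x) = norm x"
proof -
  have "orthogonal_transformation ((*v) (transpose T))"
    using assms by (subst orthogonal_transformation_matrix) (simp del: transpose_matrix_vector)
  then show ?thesis by (rule orthogonal_transformation_norm)
qed

text \<open>
  In the rotated coordinates the noise-free output depends on a single coordinate of the regressor.
\<close>

lemma phi_inner_theta:
  fixes T :: "real^'n^'n"
  assumes "orthogonal_matrix T" "matrix_inv T *v theta = axis i1 theta1"
  shows "phi t w \<bullet> theta = theta1 * tregressor T phi t w $ i1"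
proof -
  have "\<exists>A'. T ** A' = mat 1 \<and> A' ** T = mat 1"
    using assms(1) by (auto simp: orthogonal_matrix_def)
  then have "T ** matrix_inv T = mat 1 \<and> matrix_inv T ** T = mat 1"
    unfolding matrix_inv_def by (rule someI_ex)
  then have "theta = T *v (matrix_inv T *v theta)"
    by (simp add: matrix_vector_mul_assoc)
  also have "\<dots> = T *v axis i1 theta1" using assms(2) by simp
  finally have "phi t w \<bullet> theta = (phi t w v* T) \<bullet> axis i1 theta1"
    by (simp add: dot_lmul_matrix)
  then show ?thesis by (simp add: tregressor_def inner_axis mult.commute)
qed

lemma rotated_correlation_nth:
  fixes phi :: "'N::finite \<Rightarrow> 'w \<Rightarrow> real^'n::finite" and T :: "real^'n^'n"
  assumes "orthogonal_matrix T" "matrix_inv T *v theta = axis i1 theta1"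
  shows "(transpose (Umat phi w ** T) *v Evec q theta phi w) $ k =
    (\<Sum>t\<in>UNIV. tregressor T phi t w $ k * err q theta1 (tregressor T phi t w $ i1))"
proof -
  have "(Umat phi w ** T) $ t $ k = tregressor T phi t w $ k" for t
    by (simp add: matrix_matrix_mult_def Umat_def tregressor_def vector_matrix_mult_def mult.commute)
  then show ?thesis
    by (simp add: matrix_vector_mult_def transpose_def Evec_def err_def phi_inner_theta[OF assms])
qed

lemma V_rotation_invariant:
  fixes phi :: "'N::finite \<Rightarrow> 'w \<Rightarrow> real^'n::finite" and T :: "real^'n^'n"
  assumes "orthogonal_matrix T"
  shows "V P (\<lambda>w. transpose (Umat phi w) *v Evec q theta phi w) =
    V P (\<lambda>w. transpose (Umat phi w ** T) *v Evec q theta phi w)"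
  unfolding V_def matrix_transpose_mul matrix_vector_mul_assoc[symmetric]
    orthogonal_matrix_rotated_norm[OF assms] ..

section \<open>The error moments of one cell\<close>

text \<open>
  \<open>F\<close> is the antiderivative of \<open>(x\<^sup>2 + s) (m + delta - x)\<^sup>2\<close>, and \<open>delta\<close> is the offset of the prescribed
  level from the midpoint \<open>m\<close> of the cell. In terms of \<open>m\<close>, the half-length \<open>h\<close> and \<open>delta\<close> both sides are
  polynomials, which agree because of \<open>h\<^sup>2 = 3 m delta\<close>.
\<close>

lemma weighted_cell_error_integral:
  fixes m h s delta :: real
  assumes "m \<noteq> 0" and delta: "delta = h\<^sup>2 / (3 * m)"
    and F: "F = (\<lambda>x. x ^ 5 / 5 - (m + delta) * x ^ 4 / 2 + ((m + delta)\<^sup>2 + s) * x ^ 3 / 3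
        - s * (m + delta) * x\<^sup>2 + s * (m + delta)\<^sup>2 * x)"
  shows "F (m + h) - F (m - h) = cell_cost (60 * s) (m - h) (m + h) / 2160"
proof -
  have h2: "h\<^sup>2 = 3 * m * delta" using assms by simp
  have red: "h ^ 7 / m\<^sup>2 = 9 * h ^ 3 * delta\<^sup>2" "h ^ 5 / m\<^sup>2 = 9 * h * delta\<^sup>2"
    unfolding delta using assms(1) by (simp_all add: field_simps eval_nat_numeral)
  have "cell_cost (60 * s) (m - h) (m + h) =
     1440 * m\<^sup>2 * h ^ 3 - 576 * h ^ 5 + 160 * (h ^ 7 / m\<^sup>2) + 60 * s * (24 * h ^ 3 + 8 * (h ^ 5 / m\<^sup>2))"
    by (simp add: cell_cost_centered[OF assms(1)])
  also have "\<dots> = 1440 * m\<^sup>2 * h ^ 3 - 576 * h ^ 5 + 1440 * h ^ 3 * delta\<^sup>2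
      + 60 * s * (24 * h ^ 3 + 72 * h * delta\<^sup>2)"
    unfolding red by simp
  also have "\<dots> = 2160 * (F (m + h) - F (m - h))"
  proof -
    have "30 * (F (m + h) - F (m - h)) = 
      6 * ((m + h) ^ 5 - (m - h) ^ 5) - 15 * (m + delta) * ((m + h) ^ 4 - (m - h) ^ 4)
      + 10 * ((m + delta)\<^sup>2 + s) * ((m + h) ^ 3 - (m - h) ^ 3)
      - 30 * s * (m + delta) * ((m + h)\<^sup>2 - (m - h)\<^sup>2) + 30 * s * (m + delta)\<^sup>2 * ((m + h) - (m - h))"
      unfolding F by (simp add: field_simps)
    also have "\<dots> = 20 * m\<^sup>2 * h ^ 3 - 8 * h ^ 5 + 20 * h ^ 3 * delta\<^sup>2 + 20 * s * h ^ 3 + 60 * s * h * delta\<^sup>2"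
    proof -
      have "6 * ((m + h) ^ 5 - (m - h) ^ 5) - 15 * (m + delta) * ((m + h) ^ 4 - (m - h) ^ 4)
        + 10 * ((m + delta)\<^sup>2 + s) * ((m + h) ^ 3 - (m - h) ^ 3)
        - 30 * s * (m + delta) * ((m + h)\<^sup>2 - (m - h)\<^sup>2) + 30 * s * (m + delta)\<^sup>2 * ((m + h) - (m - h)) =
        20 * m\<^sup>2 * h ^ 3 - 8 * h ^ 5 + 20 * h ^ 3 * delta\<^sup>2 + 20 * s * h ^ 3 + 60 * s * h * delta\<^sup>2
        + 20 * h * (h\<^sup>2 - m * delta) * (h\<^sup>2 - 3 * m * delta)"
        by algebra
      then show ?thesis using h2 by simp
    qed
    finally show ?thesis by (simp add: field_simps)
  qed
  finally show ?thesis by simp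
qed

lemma set_lborel_integral_interval:
  fixes f g G :: "real \<Rightarrow> real"
  assumes "u < v" "{u<..<v} \<subseteq> A" "A \<subseteq> {u..v}" "\<And>x. x \<in> A \<Longrightarrow> f x = g x"
    and "\<And>x. (G has_real_derivative g x) (at x)" "\<And>x. isCont g x"
  shows "(LINT x:A|lborel. f x) = G v - G u"
proof -
  have "(LINT x:A|lborel. f x) = (LINT x:A|lborel. g x)"
    unfolding set_lebesgue_integral_def using assms(4)
    by (intro Bochner_Integration.integral_cong) (auto simp: indicator_def)
  also have "\<dots> = (LINT x:{u..v}|lborel. g x)"
  proof (rule set_integral_discrete_difference[where X = "{u, v}"])
    have "x \<in> {u, v}" if "x \<in> {u..v}" "x \<notin> A" for x
    proof -
      have "\<not> (u < x \<and> x < v)" using that assms(2) by auto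
      then show ?thesis using that(1) by auto
    qed
    then show "(A - {u..v}) \<union> ({u..v} - A) \<subseteq> {u, v}" using assms(3) by blast
  qed auto
  also have "\<dots> = G v - G u"
    using lborel_integral_indicator_FTC(1)[of u v G g] assms by (simp add: set_lebesgue_integral_def)
  finally show ?thesis .
qed

text \<open>
  Which endpoints belong to \<open>A\<close> makes no difference to the integrals, so the cells of either sign are
  covered. The second integral, taken in the regressor coordinate, is the cell cost in output units:
  the substitution \<open>y = theta x\<close> contributes \<open>theta\<^sup>5\<close> by homogeneity.
\<close>

lemma cell_integrals:
  fixes i1 :: "'n::finite"
  assumes kappa: "0 < kappa" and theta: "0 < theta" and uv: "- kappa \<le> u" "u < v" "v \<le> kappa"
    and A: "{u<..<v} \<subseteq> A" "A \<subseteq> {u..v}" and l: "\<And>x. x \<in> A \<Longrightarrow> q (theta * x) = l"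
  shows "(LINT x:A|lborel. x * err q theta x * marginal i1 (uniform_density kappa) x) =
      (l * (v\<^sup>2 - u\<^sup>2) / 2 - theta * (v ^ 3 - u ^ 3) / 3) / (2 * kappa)"
    and "u + v \<noteq> 0 \<Longrightarrow> l * (v\<^sup>2 - u\<^sup>2) / 2 = theta * (v ^ 3 - u ^ 3) / 3 \<Longrightarrow>
      (LINT x:A|lborel. sigma2 i1 (uniform_density kappa) x * (err q theta x)\<^sup>2 * marginal i1 (uniform_density kappa) x) =
      cell_cost (20 * (kappa * theta)\<^sup>2 * (real CARD('n) - 1)) (theta * u) (theta * v) / (4320 * (kappa * theta) * theta\<^sup>2)"
proof -
  have inside: "indicator {- kappa..kappa} x = (1::real)" if "x \<in> A" for x
    using that A uv by (auto simp: subset_eq)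
  have marg: "x * err q theta x * marginal i1 (uniform_density kappa) x = x * (l - theta * x) / (2 * kappa)"
    if "x \<in> A" for x
    using l[OF that] inside[OF that] kappa by (simp add: err_def marginal_uniform)
  have "(LINT x:A|lborel. x * err q theta x * marginal i1 (uniform_density kappa) x) =
      (\<lambda>x. (l * x\<^sup>2 / 2 - theta * x ^ 3 / 3) / (2 * kappa)) v - (\<lambda>x. (l * x\<^sup>2 / 2 - theta * x ^ 3 / 3) / (2 * kappa)) u"
    by (rule set_lborel_integral_interval[OF uv(2) A marg])
      (use kappa in \<open>auto intro!: derivative_eq_intros continuous_intros simp: field_simps power2_eq_square\<close>)
  then show "(LINT x:A|lborel. x * err q theta x * marginal i1 (uniform_density kappa) x) =
      (l * (v\<^sup>2 - u\<^sup>2) / 2 - theta * (v ^ 3 - u ^ 3) / 3) / (2 * kappa)"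
    by (simp add: diff_divide_distrib right_diff_distrib)
  assume sum: "u + v \<noteq> 0" and centroid: "l * (v\<^sup>2 - u\<^sup>2) / 2 = theta * (v ^ 3 - u ^ 3) / 3"
  define s where "s = (real CARD('n) - 1) * kappa\<^sup>2 / 3"
  define m h delta where "m = (u + v) / 2" and "h = (v - u) / 2" and "delta = h\<^sup>2 / (3 * m)"
  have uv_eq: "u = m - h" "v = m + h" by (auto simp: m_def h_def field_simps)
  have m: "m \<noteq> 0" using sum by (simp add: m_def)
  have h: "h \<noteq> 0" using uv by (simp add: h_def)
  have lev: "l = theta * (m + delta)"
  proof -
    have "(l * (6 * m) - theta * (6 * m\<^sup>2 + 2 * h\<^sup>2)) * h = 0"
      using centroid unfolding uv_eq by (simp add: field_simps power2_eq_square power3_eq_cube)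
    then have "l * (6 * m) = theta * (6 * m\<^sup>2 + 2 * h\<^sup>2)" using h by simp
    then show ?thesis using m by (simp add: delta_def field_simps power2_eq_square)
  qed
  define F where "F = (\<lambda>x. x ^ 5 / 5 - (m + delta) * x ^ 4 / 2 + ((m + delta)\<^sup>2 + s) * x ^ 3 / 3
        - s * (m + delta) * x\<^sup>2 + s * (m + delta)\<^sup>2 * x)"
  have DF: "(F has_real_derivative (x\<^sup>2 + s) * (m + delta - x)\<^sup>2) (at x)" for x
    unfolding F_def
    by (auto intro!: derivative_eq_intros simp: field_simps power2_eq_square eval_nat_numeral)
  have cost: "sigma2 i1 (uniform_density kappa) x * (err q theta x)\<^sup>2 * marginal i1 (uniform_density kappa) x =
      theta\<^sup>2 / (2 * kappa) * ((x\<^sup>2 + s) * (m + delta - x)\<^sup>2)" if "x \<in> A" for x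
  proof -
    have "sigma2 i1 (uniform_density kappa) x * (err q theta x)\<^sup>2 * marginal i1 (uniform_density kappa) x =
        (sigma2 i1 (uniform_density kappa) x * marginal i1 (uniform_density kappa) x) * (err q theta x)\<^sup>2"
      by simp
    also have "\<dots> = (x\<^sup>2 + s) / (2 * kappa) * (theta * (m + delta - x))\<^sup>2"
      using l[OF that] inside[OF that] kappa
      by (simp add: sigma2_marginal_uniform s_def err_def lev right_diff_distrib)
    finally show ?thesis by (simp add: power_mult_distrib)
  qed
  have "(LINT x:A|lborel. sigma2 i1 (uniform_density kappa) x * (err q theta x)\<^sup>2 * marginal i1 (uniform_density kappa) x) =
      (\<lambda>x. theta\<^sup>2 / (2 * kappa) * F x) v - (\<lambda>x. theta\<^sup>2 / (2 * kappa) * F x) u"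
    by (rule set_lborel_integral_interval[OF uv(2) A cost], assumption, rule DERIV_cmult[OF DF])
      (use kappa in \<open>auto intro!: continuous_intros\<close>)
  also have "\<dots> = theta\<^sup>2 / (2 * kappa) * (F v - F u)" by (simp add: right_diff_distrib)
  also have "F v - F u = cell_cost (60 * s) u v / 2160"
    unfolding uv_eq by (rule weighted_cell_error_integral[OF m delta_def F_def])
  also have "theta\<^sup>2 / (2 * kappa) * (cell_cost (60 * s) u v / 2160) =
      theta ^ 5 * cell_cost (60 * s) u v / (4320 * (kappa * theta) * theta\<^sup>2)"
    using theta kappa by (simp add: field_simps eval_nat_numeral)
  also have "theta ^ 5 * cell_cost (60 * s) u v = cell_cost (60 * s * theta\<^sup>2) (theta * u) (theta * v)"
    using cell_cost_scale[OF theta] by simp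
  also have "60 * s * theta\<^sup>2 = 20 * (kappa * theta)\<^sup>2 * (real CARD('n) - 1)"
    by (simp add: s_def power_mult_distrib)
  finally show "(LINT x:A|lborel. sigma2 i1 (uniform_density kappa) x * (err q theta x)\<^sup>2 * marginal i1 (uniform_density kappa) x) =
      cell_cost (20 * (kappa * theta)\<^sup>2 * (real CARD('n) - 1)) (theta * u) (theta * v) / (4320 * (kappa * theta) * theta\<^sup>2)" .
qed

section \<open>The partition into cells\<close>

definition boundaries :: "nat \<Rightarrow> real \<Rightarrow> (int \<Rightarrow> real) \<Rightarrow> bool" where
  "boundaries m K d \<longleftrightarrow> d 0 = 0 \<and> (\<forall>j\<in>{0..<int m}. d j < d (j + 1)) \<and> d (int m) = K \<and>
     (\<forall>j\<in>{0..int m}. d (- j) = - d j)"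

lemma boundaries_less:
  assumes "boundaries m K d" "0 \<le> i" "i < j" "j \<le> int m"
  shows "d i < d j"
proof -
  have "j \<le> int m \<longrightarrow> d i < d j" if "i + 1 \<le> j" for j
    using that
  proof (induction j rule: int_ge_induct)
    case base
    then show ?case using assms by (auto simp: boundaries_def)
  next
    case (step j)
    show ?case
    proof
      assume "j + 1 \<le> int m"
      then have "d i < d j" "d j < d (j + 1)"
        using step assms by (auto simp: boundaries_def)
      then show "d i < d (j + 1)" by simp
    qed
  qed
  then show ?thesis using assms by simp
qed

lemma boundaries_le:
  assumes "boundaries m K d" "0 \<le> i" "i \<le> j" "j \<le> int m"
  shows "d i \<le> d j"
  using boundaries_less[OF assms(1), of i j] assms by (cases "i = j") auto

lemma cell_reflect:
  assumes "boundaries m K d" "j \<in> {- int m..int m}"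
  shows "y \<in> cell d (- j) \<longleftrightarrow> - y \<in> cell d j"
proof -
  have neg: "d (- i) = - d i" if "i \<in> {- int m..int m}" for i
  proof (cases "0 \<le> i")
    case True
    then show ?thesis using assms(1) that by (auto simp: boundaries_def)
  next
    case False
    then have "d (- (- i)) = - d (- i)" using assms(1) that by (auto simp: boundaries_def simp del: minus_minus)
    then show ?thesis by simp
  qed
  consider "j = 0" | "0 < j" | "j < 0" by linarith
  then show ?thesis
  proof cases
    case 2
    then have "d (- j) = - d j" "d (- j + 1) = - d (j - 1)"
      using neg[of j] neg[of "j - 1"] assms(2) by auto
    then show ?thesis using 2 by (auto simp: cell_def)
  next
    case 3
    then have "d (- j) = - d j" "d (- j - 1) = - d (j + 1)"
      using neg[of j] neg[of "j + 1"] assms(2) by auto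
    then show ?thesis using 3 by (auto simp: cell_def)
  qed (auto simp: cell_def)
qed

text \<open>
  Separates the cells of positive, zero and negative index; the uniqueness and covering properties
  then need to be shown for positive indices only and transfer by reflection.
\<close>

lemma cell_sign:
  assumes "boundaries m K d" "j \<in> {- int m..int m}" "y \<in> cell d j"
  shows "sgn y = of_int (sgn j)"
proof -
  have pos: "0 < y" if "j \<in> {1..int m}" "y \<in> cell d j" for j y
    using that boundaries_le[OF assms(1), of 0 "j - 1"] assms(1)
    by (auto simp: cell_def boundaries_def)
  consider "j = 0" | "0 < j" | "j < 0" by linarith
  then show ?thesis
  proof cases
    case 3
    then have "- y \<in> cell d (- j)" using cell_reflect[OF assms(1), of "- j" y] assms by auto
    then show ?thesis using pos[of "- j" "- y"] 3 assms(2) by auto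
  qed (use pos[of j y] assms in \<open>auto simp: cell_def\<close>)
qed

lemma cell_unique:
  assumes "boundaries m K d" "i \<in> {- int m..int m}" "j \<in> {- int m..int m}" "y \<in> cell d i" "y \<in> cell d j"
  shows "i = j"
proof -
  have pos: "i = j" if "i \<in> {1..int m}" "j \<in> {1..int m}" "y \<in> cell d i" "y \<in> cell d j" for i j y
  proof -
    have "\<not> i < j" if "i \<in> {1..int m}" "j \<in> {1..int m}" "y \<in> cell d i" "y \<in> cell d j" for i j
      using that boundaries_le[OF assms(1), of i "j - 1"] by (auto simp: cell_def)
    then show ?thesis using that by (meson linorder_neqE)
  qed
  have "sgn i = sgn j"
    using cell_sign[OF assms(1) assms(2) assms(4)] cell_sign[OF assms(1) assms(3) assms(5)]
    by (metis of_int_eq_iff)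
  then consider "i = 0" "j = 0" | "0 < i" "0 < j" | "i < 0" "j < 0"
    by (auto simp: sgn_if split: if_splits)
  then show ?thesis
  proof cases
    case 3
    then have "- y \<in> cell d (- i)" "- y \<in> cell d (- j)"
      using cell_reflect[OF assms(1), of "- i" y] cell_reflect[OF assms(1), of "- j" y] assms by auto
    then show ?thesis using pos[of "- i" "- j" "- y"] 3 assms by auto
  qed (use pos[of i j y] assms in auto)
qed

lemma cell_cover:
  assumes "boundaries m K d"
  shows "(\<Union>j\<in>{- int m..int m}. cell d j) = {- K..K}"
proof
  have pos: "y \<le> K" if "j \<in> {1..int m}" "y \<in> cell d j" for j y
    using that boundaries_le[OF assms, of j "int m"] assms by (auto simp: cell_def boundaries_def)
  have K: "0 \<le> K" using boundaries_le[OF assms, of 0 "int m"] assms by (auto simp: boundaries_def)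
  have bound: "y \<le> K" if "j \<in> {- int m..int m}" "y \<in> cell d j" for j y
  proof (cases "0 < j")
    case True
    then show ?thesis using pos[of j y] that by auto
  next
    case False
    then have "sgn y \<le> 0" using cell_sign[OF assms that] by (auto simp: sgn_if)
    then have "y \<le> 0" by simp
    then show ?thesis using K by simp
  qed
  show "(\<Union>j\<in>{- int m..int m}. cell d j) \<subseteq> {- K..K}"
  proof
    fix y assume "y \<in> (\<Union>j\<in>{- int m..int m}. cell d j)"
    then obtain j where j: "j \<in> {- int m..int m}" "y \<in> cell d j" by blast
    then have "- y \<in> cell d (- j)" using cell_reflect[OF assms, of "- j" y] by auto
    then show "y \<in> {- K..K}" using bound[OF j] bound[of "- j" "- y"] j by auto
  qed
  have cover_pos: "\<exists>j\<in>{1..int m}. y \<in> cell d j" if "0 < y" "y \<le> K" for y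
  proof -
    have "d (int k) < y \<or> (\<exists>j\<in>{1..int m}. y \<in> cell d j)" if "k \<le> m" for k
      using that
    proof (induction k)
      case 0
      then show ?case using \<open>0 < y\<close> assms by (simp add: boundaries_def)
    next
      case (Suc k)
      then consider "d (int k) < y" "y \<le> d (int (Suc k))" | "d (int (Suc k)) < y"
          | "\<exists>j\<in>{1..int m}. y \<in> cell d j"
        by fastforce
      then show ?case
      proof cases
        case 1
        then have "y \<in> cell d (int (Suc k))" by (auto simp: cell_def)
        then show ?thesis using Suc.prems by (intro disjI2 bexI) auto
      qed auto
    qed
    from this[of m] show ?thesis using that assms by (auto simp: boundaries_def)
  qed
  show "{- K..K} \<subseteq> (\<Union>j\<in>{- int m..int m}. cell d j)"
  proof
    fix y assume y: "y \<in> {- K..K}"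
    consider "y = 0" | "0 < y" | "y < 0" by linarith
    then show "y \<in> (\<Union>j\<in>{- int m..int m}. cell d j)"
    proof cases
      case 1
      then have "y \<in> cell d 0" by (simp add: cell_def)
      then show ?thesis by (intro UN_I[of 0]) auto
    next
      case 2
      then obtain j where "j \<in> {1..int m}" "y \<in> cell d j" using cover_pos[of y] y by auto
      then show ?thesis by (intro UN_I[of j]) auto
    next
      case 3
      then obtain j where j: "j \<in> {1..int m}" "- y \<in> cell d j" using cover_pos[of "- y"] y by auto
      then have "y \<in> cell d (- j)" using cell_reflect[OF assms, of j y] by auto
      then show ?thesis using j by (intro UN_I[of "- j"]) auto
    qed
  qed
qed

lemma cell_measurable: "cell d j \<in> sets borel"
  by (simp add: cell_def)

lemma I_set_measurable: "I_set theta d j \<in> sets lborel"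
proof -
  have "I_set theta d j = (\<lambda>x. theta * x) -` cell d j \<inter> space borel" by (auto simp: I_set_def)
  also have "\<dots> \<in> sets borel" by (rule measurable_sets[OF _ cell_measurable]) simp
  finally show ?thesis by simp
qed

text \<open>
  On the support each point lies in exactly one cell, so the indicators of the cells add up to one.
\<close>

lemma integral_split_cells:
  fixes f :: "real \<Rightarrow> real"
  assumes d: "boundaries m (kappa * theta) d" and theta: "0 < theta"
    and f: "f \<in> borel_measurable borel" "\<And>x. x \<notin> {- kappa..kappa} \<Longrightarrow> f x = 0"
      "\<And>x. x \<in> {- kappa..kappa} \<Longrightarrow> \<bar>f x\<bar> \<le> B"
  shows "(\<integral>x. f x \<partial>lborel) = (\<Sum>j\<in>{- int m..int m}. LINT x:I_set theta d j|lborel. f x)"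
proof -
  have split: "f x = (\<Sum>j\<in>{- int m..int m}. indicator (I_set theta d j) x *\<^sub>R f x)" for x
  proof (cases "x \<in> {- kappa..kappa}")
    case True
    then have "theta * x \<in> {- (kappa * theta)..kappa * theta}"
      using theta mult_right_mono[of "- kappa" x theta] mult_right_mono[of x kappa theta]
      by (simp add: mult.commute)
    then have "theta * x \<in> (\<Union>j\<in>{- int m..int m}. cell d j)"
      by (simp only: cell_cover[OF d])
    then obtain j where j: "j \<in> {- int m..int m}" "theta * x \<in> cell d j" by blast
    have "(\<Sum>i\<in>{- int m..int m}. indicator (I_set theta d i) x *\<^sub>R f x) =
        (\<Sum>i\<in>{- int m..int m}. if i = j then f x else 0)"
    proof (rule sum.cong[OF refl])
      fix i assume "i \<in> {- int m..int m}"
      then have "x \<in> I_set theta d i \<longleftrightarrow> i = j"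
        using cell_unique[OF d _ j(1) _ j(2), of i] j(2) unfolding I_set_def by blast
      then show "indicator (I_set theta d i) x *\<^sub>R f x = (if i = j then f x else 0)"
        by (simp add: indicator_def)
    qed
    then show ?thesis using j by simp
  qed (simp add: f)
  have "integrable lborel f"
  proof (rule integrableI_bounded_set[where A = "{- kappa..kappa}" and B = B])
    show "emeasure lborel {- kappa..kappa} < \<infinity>" by (simp add: emeasure_lborel_Icc_eq)
  qed (use f in \<open>auto intro!: AE_I2\<close>)
  then have "integrable lborel (\<lambda>x. indicator (I_set theta d j) x *\<^sub>R f x)" for j
    by (rule integrable_mult_indicator[OF I_set_measurable])
  then have "(\<integral>x. (\<Sum>j\<in>{- int m..int m}. indicator (I_set theta d j) x *\<^sub>R f x) \<partial>lborel) =
      (\<Sum>j\<in>{- int m..int m}. LINT x:I_set theta d j|lborel. f x)"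
    unfolding set_lebesgue_integral_def by (intro Bochner_Integration.integral_sum) auto
  then show ?thesis by (simp only: split[symmetric])
qed

section \<open>Feasible quantizers\<close>

lemma quantizer_iff_boundaries:
  "quantizer m K d q \<longleftrightarrow> q \<in> borel_measurable borel \<and> boundaries m K d \<and>
     (\<exists>lev. (\<forall>j\<in>{0..int m}. lev (- j) = - lev j) \<and>
        (\<forall>j\<in>{- int m..int m}. \<forall>y\<in>cell d j. q y = lev j))"
  by (simp add: quantizer_def boundaries_def conj_ac)

lemma I_set_interval:
  assumes theta: "0 < theta" and d: "boundaries m (kappa * theta) d" and j: "1 \<le> j" "j \<le> int m"
  shows "0 \<le> d (j - 1) / theta" "d (j - 1) / theta < d j / theta" "d j / theta \<le> kappa"
    and "{d (j - 1) / theta<..<d j / theta} \<subseteq> I_set theta d j"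
      "I_set theta d j \<subseteq> {d (j - 1) / theta..d j / theta}"
    and "{- (d j / theta)<..<- (d (j - 1) / theta)} \<subseteq> I_set theta d (- j)"
      "I_set theta d (- j) \<subseteq> {- (d j / theta)..- (d (j - 1) / theta)}"
proof -
  have "0 \<le> d (j - 1)" "d (j - 1) < d j" "d j \<le> kappa * theta"
    using boundaries_le[OF d, of 0 "j - 1"] boundaries_less[OF d, of "j - 1" j]
      boundaries_le[OF d, of j "int m"] d j by (auto simp: boundaries_def)
  then show "0 \<le> d (j - 1) / theta" "d (j - 1) / theta < d j / theta" "d j / theta \<le> kappa"
    using theta by (auto simp: field_simps)
  have mem: "x \<in> I_set theta d j \<longleftrightarrow> d (j - 1) / theta < x \<and> x \<le> d j / theta" for x
    using theta j by (simp add: I_set_def cell_def field_simps)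
  have "x \<in> I_set theta d (- j) \<longleftrightarrow> - x \<in> I_set theta d j" for x
    using cell_reflect[OF d, of j "theta * x"] j by (simp add: I_set_def)
  then have mem': "x \<in> I_set theta d (- j) \<longleftrightarrow> d (j - 1) / theta < - x \<and> - x \<le> d j / theta" for x
    by (simp add: mem)
  show "{d (j - 1) / theta<..<d j / theta} \<subseteq> I_set theta d j"
      "I_set theta d j \<subseteq> {d (j - 1) / theta..d j / theta}"
    by (auto simp: mem)
  show "{- (d j / theta)<..<- (d (j - 1) / theta)} \<subseteq> I_set theta d (- j)"
    "I_set theta d (- j) \<subseteq> {- (d j / theta)..- (d (j - 1) / theta)}"
  proof -
    have "x \<in> I_set theta d (- j)" if "x \<in> {- (d j / theta)<..<- (d (j - 1) / theta)}" for x
      using that unfolding mem' greaterThanLessThan_iff by linarith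
    then show "{- (d j / theta)<..<- (d (j - 1) / theta)} \<subseteq> I_set theta d (- j)" by blast
    have "x \<in> {- (d j / theta)..- (d (j - 1) / theta)}" if "x \<in> I_set theta d (- j)" for x
      using that unfolding mem' atLeastAtMost_iff by linarith
    then show "I_set theta d (- j) \<subseteq> {- (d j / theta)..- (d (j - 1) / theta)}" by blast
  qed
qed

lemma set_lborel_integral_I_set_0:
  fixes f :: "real \<Rightarrow> real"
  assumes "0 < theta"
  shows "(LINT x:I_set theta d 0|lborel. f x) = 0"
proof -
  have "I_set theta d 0 = {0}" using assms by (auto simp: I_set_def cell_def)
  moreover have "(LINT x:{0::real}|lborel. f x) = (LINT x:{}|lborel. f x)"
    by (rule set_integral_discrete_difference[where X = "{0}"]) auto
  ultimately show ?thesis by (simp add: set_lebesgue_integral_def)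
qed

text \<open>
  Reflected cells with opposite levels have the same moment, as the integrand \<open>x e(x)\<close> is even.
\<close>

lemma E_I_eq:
  fixes i1 :: "'n::finite"
  assumes kappa: "0 < kappa" and theta: "0 < theta" and d: "boundaries m (kappa * theta) d"
    and j: "1 \<le> j" "j \<le> int m"
    and l: "\<And>y. y \<in> cell d j \<Longrightarrow> q y = l" "\<And>y. y \<in> cell d (- j) \<Longrightarrow> q y = - l"
  defines "u \<equiv> d (j - 1) / theta" and "v \<equiv> d j / theta"
  shows "E_I i1 (uniform_density kappa) theta d q j =
      (l * (v\<^sup>2 - u\<^sup>2) / 2 - theta * (v ^ 3 - u ^ 3) / 3) / (2 * kappa)"
    and "E_I i1 (uniform_density kappa) theta d q (- j) =
      (l * (v\<^sup>2 - u\<^sup>2) / 2 - theta * (v ^ 3 - u ^ 3) / 3) / (2 * kappa)"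
proof -
  note iv = I_set_interval[OF theta d j, folded u_def v_def]
  have l': "q (theta * x) = l" if "x \<in> I_set theta d j" for x
    using that l(1) by (simp add: I_set_def)
  have l'': "q (theta * x) = - l" if "x \<in> I_set theta d (- j)" for x
    using that l(2) by (simp add: I_set_def)
  show "E_I i1 (uniform_density kappa) theta d q j =
      (l * (v\<^sup>2 - u\<^sup>2) / 2 - theta * (v ^ 3 - u ^ 3) / 3) / (2 * kappa)"
    unfolding E_I_def using iv kappa
    by (intro cell_integrals(1)[where q = q and l = l, OF kappa theta _ iv(2) iv(3) iv(4) iv(5) l']) auto
  have "E_I i1 (uniform_density kappa) theta d q (- j) =
      (- l * ((- u)\<^sup>2 - (- v)\<^sup>2) / 2 - theta * ((- u) ^ 3 - (- v) ^ 3) / 3) / (2 * kappa)"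
    unfolding E_I_def using iv(1-3)
    by (intro cell_integrals(1)[where q = q and l = "- l", OF kappa theta _ _ _ iv(6) iv(7) l'']) auto
  also have "\<dots> = (l * (v\<^sup>2 - u\<^sup>2) / 2 - theta * (v ^ 3 - u ^ 3) / 3) / (2 * kappa)"
    by (simp add: right_diff_distrib diff_divide_distrib)
  finally show "E_I i1 (uniform_density kappa) theta d q (- j) =
      (l * (v\<^sup>2 - u\<^sup>2) / 2 - theta * (v ^ 3 - u ^ 3) / 3) / (2 * kappa)" .
qed

lemma V_I_eq:
  fixes i1 :: "'n::finite" and N :: nat
  assumes kappa: "0 < kappa" and theta: "0 < theta" and d: "boundaries m (kappa * theta) d"
    and j: "1 \<le> j" "j \<le> int m"
    and l: "\<And>y. y \<in> cell d j \<Longrightarrow> q y = l" "\<And>y. y \<in> cell d (- j) \<Longrightarrow> q y = - l"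
    and E: "E_I i1 (uniform_density kappa) theta d q j = 0"
  defines "c \<equiv> real N * (cell_cost (20 * (kappa * theta)\<^sup>2 * (real CARD('n) - 1)) (d (j - 1)) (d j)
      / (4320 * (kappa * theta) * theta\<^sup>2))"
  shows "V_I N i1 (uniform_density kappa) theta d q j = c"
    and "V_I N i1 (uniform_density kappa) theta d q (- j) = c"
proof -
  define u v where "u = d (j - 1) / theta" and "v = d j / theta"
  note iv = I_set_interval[OF theta d j, folded u_def v_def]
  have duv: "d (j - 1) = theta * u" "d j = theta * v" using theta by (auto simp: u_def v_def)
  have centroid: "l * (v\<^sup>2 - u\<^sup>2) / 2 = theta * (v ^ 3 - u ^ 3) / 3"
    using E E_I_eq(1)[where q = q and l = l and ?i1.0 = i1, OF kappa theta d j l] kappa by (simp add: u_def v_def)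
  have l': "q (theta * x) = l" if "x \<in> I_set theta d j" for x
    using that l(1) by (simp add: I_set_def)
  have l'': "q (theta * x) = - l" if "x \<in> I_set theta d (- j)" for x
    using that l(2) by (simp add: I_set_def)
  show "V_I N i1 (uniform_density kappa) theta d q j = c"
    unfolding V_I_def c_def duv using iv(1-3)
    by (intro arg_cong[where f = "(*) (real N)"]
      cell_integrals(2)[where q = q and l = l, OF kappa theta _ iv(2) iv(3) iv(4) iv(5) l' _ centroid]) auto
  have "V_I N i1 (uniform_density kappa) theta d q (- j) =
      real N * (cell_cost (20 * (kappa * theta)\<^sup>2 * (real CARD('n) - 1)) (theta * (- v)) (theta * (- u))
      / (4320 * (kappa * theta) * theta\<^sup>2))"
    unfolding V_I_def
  proof (intro arg_cong[where f = "(*) (real N)"]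
      cell_integrals(2)[where q = q and l = "- l", OF kappa theta _ _ _ iv(6) iv(7) l''])
    show "- l * ((- u)\<^sup>2 - (- v)\<^sup>2) / 2 = theta * ((- u) ^ 3 - (- v) ^ 3) / 3"
      using centroid by (simp add: algebra_simps)
  qed (use iv(1-3) in auto)
  then show "V_I N i1 (uniform_density kappa) theta d q (- j) = c"
    unfolding c_def duv by (simp add: cell_cost_reflect)
qed

lemma sum_symmetric_int:
  fixes f :: "int \<Rightarrow> real"
  shows "(\<Sum>j\<in>{- int m..int m}. f j) = f 0 + (\<Sum>i<m. f (int (Suc i)) + f (- int (Suc i)))"
proof (induction m)
  case (Suc m)
  have "{- int (Suc m)..int (Suc m)} = insert (int (Suc m)) (insert (- int (Suc m)) {- int m..int m})"
    by auto
  then have "(\<Sum>j\<in>{- int (Suc m)..int (Suc m)}. f j) =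
      f (int (Suc m)) + (f (- int (Suc m)) + (\<Sum>j\<in>{- int m..int m}. f j))"
    by simp
  then show ?case using Suc by simp
qed simp

lemma feasible_err_bounded:
  assumes theta: "0 < theta" and feas: "feasible m i1 f theta (kappa * theta) d q"
  shows "err q theta \<in> borel_measurable borel"
    and "\<exists>B. \<forall>x\<in>{- kappa..kappa}. \<bar>err q theta x\<bar> \<le> B"
proof -
  have q: "q \<in> borel_measurable borel" and d: "boundaries m (kappa * theta) d"
    using feas by (auto simp: feasible_def quantizer_iff_boundaries)
  obtain lev where lev: "\<And>j y. j \<in> {- int m..int m} \<Longrightarrow> y \<in> cell d j \<Longrightarrow> q y = lev j"
    using feas unfolding feasible_def quantizer_iff_boundaries by blast
  have "(\<lambda>x. q (theta * x)) \<in> borel_measurable borel"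
    by (rule measurable_compose[OF _ q]) simp
  then show "err q theta \<in> borel_measurable borel"
    unfolding err_def[abs_def] by (rule borel_measurable_diff) simp
  have "\<bar>err q theta x\<bar> \<le> (\<Sum>j\<in>{- int m..int m}. \<bar>lev j\<bar>) + kappa * theta" if "x \<in> {- kappa..kappa}" for x
  proof -
    have tx: "theta * x \<in> {- (kappa * theta)..kappa * theta}"
      using theta that mult_right_mono[of "- kappa" x theta] mult_right_mono[of x kappa theta]
      by (simp add: mult.commute)
    then have "theta * x \<in> (\<Union>j\<in>{- int m..int m}. cell d j)" by (simp only: cell_cover[OF d])
    then obtain j where j: "j \<in> {- int m..int m}" "theta * x \<in> cell d j" by blast
    have "\<bar>lev j\<bar> \<le> (\<Sum>j\<in>{- int m..int m}. \<bar>lev j\<bar>)"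
      using j by (intro member_le_sum) auto
    moreover have "\<bar>theta * x\<bar> \<le> kappa * theta" using tx by auto
    ultimately show ?thesis unfolding err_def lev[OF j] by linarith
  qed
  then show "\<exists>B. \<forall>x\<in>{- kappa..kappa}. \<bar>err q theta x\<bar> \<le> B" by blast
qed

lemma feasible_mean_zero:
  assumes kappa: "0 < kappa" and theta: "0 < theta"
    and feas: "feasible m i1 (uniform_density kappa) theta (kappa * theta) d q"
  shows "(\<integral>x. x * err q theta x * marginal i1 (uniform_density kappa) x \<partial>lborel) = 0"
proof -
  note e = feasible_err_bounded[OF theta feas]
  obtain B where B: "\<bar>err q theta x\<bar> \<le> B" if "x \<in> {- kappa..kappa}" for x using e(2) by blast
  have "boundaries m (kappa * theta) d"
    using feas by (auto simp: feasible_def quantizer_iff_boundaries)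
  then have "(\<integral>x. x * err q theta x * marginal i1 (uniform_density kappa) x \<partial>lborel) =
      (\<Sum>j\<in>{- int m..int m}. E_I i1 (uniform_density kappa) theta d q j)"
    unfolding E_I_def
  proof (rule integral_split_cells[OF _ theta])
    show "(\<lambda>x. x * err q theta x * marginal i1 (uniform_density kappa) x) \<in> borel_measurable borel"
      unfolding marginal_uniform[OF kappa] using e(1) by measurable
    show "x * err q theta x * marginal i1 (uniform_density kappa) x = 0" if "x \<notin> {- kappa..kappa}" for x
      using that by (simp add: marginal_uniform[OF kappa])
    show "\<bar>x * err q theta x * marginal i1 (uniform_density kappa) x\<bar> \<le> kappa * B * (1 / (2 * kappa))"
      if "x \<in> {- kappa..kappa}" for x
      unfolding abs_mult marginal_uniform[OF kappa] using that B[OF that] kappa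
      by (intro mult_mono) auto
  qed
  then show ?thesis using feas by (simp add: feasible_def)
qed

text \<open>
  The cells \<open>j\<close> and \<open>- j\<close> contribute equally, which turns \<open>4320\<close> into \<open>2160\<close>; the cell \<open>{0}\<close> is null.
\<close>

lemma cost_sum_cells:
  fixes i1 :: "'n::finite"
  assumes kappa: "0 < kappa" and theta: "0 < theta"
    and feas: "feasible m i1 (uniform_density kappa) theta (kappa * theta) d q"
  shows "real N * (\<integral>x. sigma2 i1 (uniform_density kappa) x * (err q theta x)\<^sup>2 * marginal i1 (uniform_density kappa) x \<partial>lborel) =
      (\<Sum>j\<in>{- int m..int m}. V_I N i1 (uniform_density kappa) theta d q j)"
    and "(\<Sum>j\<in>{- int m..int m}. V_I N i1 (uniform_density kappa) theta d q j) =
      real N / (2160 * (kappa * theta) * theta\<^sup>2) *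
        (\<Sum>i<m. cell_cost (20 * (kappa * theta)\<^sup>2 * (real CARD('n) - 1)) (d (int i)) (d (int (Suc i))))"
proof -
  note e = feasible_err_bounded[OF theta feas]
  obtain B where B: "\<bar>err q theta x\<bar> \<le> B" if "x \<in> {- kappa..kappa}" for x using e(2) by blast
  have d: "boundaries m (kappa * theta) d"
    using feas by (auto simp: feasible_def quantizer_iff_boundaries)
  define s where "s = (real CARD('n) - 1) * kappa\<^sup>2 / 3"
  have integrand: "sigma2 i1 (uniform_density kappa) x * (err q theta x)\<^sup>2 * marginal i1 (uniform_density kappa) x =
      (x\<^sup>2 + s) * (indicator {- kappa..kappa} x / (2 * kappa)) * (err q theta x)\<^sup>2" for x
    using arg_cong[OF sigma2_marginal_uniform[OF kappa, of i1 x], of "\<lambda>a. a * (err q theta x)\<^sup>2"]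
    by (simp add: s_def mult_ac)
  have "(\<integral>x. sigma2 i1 (uniform_density kappa) x * (err q theta x)\<^sup>2 * marginal i1 (uniform_density kappa) x \<partial>lborel) =
      (\<Sum>j\<in>{- int m..int m}. LINT x:I_set theta d j|lborel.
        sigma2 i1 (uniform_density kappa) x * (err q theta x)\<^sup>2 * marginal i1 (uniform_density kappa) x)"
    unfolding integrand
  proof (rule integral_split_cells[OF d theta])
    show "(\<lambda>x. (x\<^sup>2 + s) * (indicator {- kappa..kappa} x / (2 * kappa)) * (err q theta x)\<^sup>2) \<in> borel_measurable borel"
      using e(1) by measurable
    show "(x\<^sup>2 + s) * (indicator {- kappa..kappa} x / (2 * kappa)) * (err q theta x)\<^sup>2 = 0" if "x \<notin> {- kappa..kappa}" for x
      using that by simp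
    show "\<bar>(x\<^sup>2 + s) * (indicator {- kappa..kappa} x / (2 * kappa)) * (err q theta x)\<^sup>2\<bar>
        \<le> (kappa\<^sup>2 + \<bar>s\<bar>) * (1 / (2 * kappa)) * B\<^sup>2"
      if x: "x \<in> {- kappa..kappa}" for x
    proof -
      have "\<bar>x\<bar> \<le> kappa" using x by auto
      then have "x\<^sup>2 \<le> kappa\<^sup>2" by (simp add: abs_le_square_iff[symmetric])
      then have "\<bar>x\<^sup>2 + s\<bar> \<le> kappa\<^sup>2 + \<bar>s\<bar>" using zero_le_power2[of x] by linarith
      moreover have "(err q theta x)\<^sup>2 \<le> B\<^sup>2"
        using B[OF x] by (simp add: abs_le_square_iff[symmetric])
      ultimately show ?thesis
        unfolding abs_mult using x kappa by (intro mult_mono) auto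
    qed
  qed
  then show "real N * (\<integral>x. sigma2 i1 (uniform_density kappa) x * (err q theta x)\<^sup>2 * marginal i1 (uniform_density kappa) x \<partial>lborel) =
      (\<Sum>j\<in>{- int m..int m}. V_I N i1 (uniform_density kappa) theta d q j)"
    by (simp add: V_I_def sum_distrib_left)
  obtain lev where antisym: "\<And>j. j \<in> {0..int m} \<Longrightarrow> lev (- j) = - lev j"
    and lev: "\<And>j y. j \<in> {- int m..int m} \<Longrightarrow> y \<in> cell d j \<Longrightarrow> q y = lev j"
    using feas unfolding feasible_def quantizer_iff_boundaries by blast
  have pair: "V_I N i1 (uniform_density kappa) theta d q (int (Suc i)) +
      V_I N i1 (uniform_density kappa) theta d q (- int (Suc i)) =
      real N / (2160 * (kappa * theta) * theta\<^sup>2) *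
        cell_cost (20 * (kappa * theta)\<^sup>2 * (real CARD('n) - 1)) (d (int i)) (d (int (Suc i)))" if "i < m" for i
  proof -
    have j: "1 \<le> int (Suc i)" "int (Suc i) \<le> int m" using that by auto
    have l: "q y = lev (int (Suc i))" if "y \<in> cell d (int (Suc i))" for y
      using lev[OF _ that] j by auto
    have l': "q y = - lev (int (Suc i))" if "y \<in> cell d (- int (Suc i))" for y
      using lev[OF _ that] antisym[of "int (Suc i)"] j by auto
    have "E_I i1 (uniform_density kappa) theta d q (int (Suc i)) = 0"
      using feas j unfolding feasible_def by auto
    note V_I_eq[where q = q and l = "lev (int (Suc i))" and ?i1.0 = i1 and N = N, OF kappa theta d j l l' this]
    moreover have "int (Suc i) - 1 = int i" by simp
    ultimately show ?thesis by simp
  qed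
  have "V_I N i1 (uniform_density kappa) theta d q 0 = 0"
    unfolding V_I_def set_lborel_integral_I_set_0[OF theta] by simp
  then show "(\<Sum>j\<in>{- int m..int m}. V_I N i1 (uniform_density kappa) theta d q j) =
      real N / (2160 * (kappa * theta) * theta\<^sup>2) *
        (\<Sum>i<m. cell_cost (20 * (kappa * theta)\<^sup>2 * (real CARD('n) - 1)) (d (int i)) (d (int (Suc i))))"
    unfolding sum_symmetric_int by (simp only: sum_distrib_left) (use pair in \<open>auto intro!: sum.cong\<close>)
qed

text \<open>
  The constraint is one linear equation for the level of each cell, solved by
  \<open>2 (a\<^sup>2 + a b + b\<^sup>2) / (3 (a + b))\<close> on the cell with endpoints \<open>a < b\<close>.
\<close>

lemma feasible_exists:
  fixes i1 :: "'n::finite"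
  assumes kappa: "0 < kappa" and theta: "0 < theta" and d: "boundaries m (kappa * theta) d"
  shows "\<exists>q. feasible m i1 (uniform_density kappa) theta (kappa * theta) d q"
proof -
  define c where "c a b = 2 * (a\<^sup>2 + a * b + b\<^sup>2) / (3 * (a + b))" for a b :: real
  define lev where "lev j = (if 0 < j then c (d (j - 1)) (d j) else if j < 0 then - c (d (- j - 1)) (d (- j)) else 0)" for j
  define q where "q y = (\<Sum>j\<in>{- int m..int m}. lev j * indicator (cell d j) y)" for y
  have q_meas: "q \<in> borel_measurable borel"
    unfolding q_def[abs_def] using cell_measurable by measurable
  have antisym: "lev (- j) = - lev j" for j by (simp add: lev_def)
  have q: "q y = lev j" if j: "j \<in> {- int m..int m}" "y \<in> cell d j" for j y
  proof -
    have "q y = (\<Sum>i\<in>{- int m..int m}. if i = j then lev j else 0)"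
      unfolding q_def
    proof (rule sum.cong[OF refl])
      fix i assume "i \<in> {- int m..int m}"
      then have "y \<in> cell d i \<longleftrightarrow> i = j" using cell_unique[OF d _ j(1) _ j(2), of i] j(2) by blast
      then show "lev i * indicator (cell d i) y = (if i = j then lev j else 0)"
        by (simp add: indicator_def)
    qed
    then show ?thesis using j by simp
  qed
  have quant: "quantizer m (kappa * theta) d q"
    unfolding quantizer_iff_boundaries using q_meas d q antisym by blast
  have pos: "E_I i1 (uniform_density kappa) theta d q j = 0 \<and> E_I i1 (uniform_density kappa) theta d q (- j) = 0"
    if j: "1 \<le> j" "j \<le> int m" for j
  proof -
    define u v where "u = d (j - 1) / theta" and "v = d j / theta"
    note iv = I_set_interval[OF theta d j, folded u_def v_def]
    have duv: "d (j - 1) = theta * u" "d j = theta * v" using theta by (auto simp: u_def v_def)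
    have "lev j = c (theta * u) (theta * v)" using j by (simp add: lev_def duv)
    also have "\<dots> = theta * c u v"
    proof -
      have "theta * u + theta * v = theta * (u + v)" by (simp add: distrib_left)
      moreover have "(theta * u)\<^sup>2 + theta * u * (theta * v) + (theta * v)\<^sup>2 = theta * (theta * (u\<^sup>2 + u * v + v\<^sup>2))"
        by (simp add: power2_eq_square algebra_simps)
      ultimately show ?thesis using theta iv(1,2) by (simp add: c_def)
    qed
    finally have lev_uv: "lev j = theta * c u v" .
    have sum: "u + v \<noteq> 0" using iv by auto
    have "c u v * (v\<^sup>2 - u\<^sup>2) / 2 = (v ^ 3 - u ^ 3) / 3"
    proof -
      have "c u v * (v\<^sup>2 - u\<^sup>2) / 2 = (c u v * (u + v)) * (v - u) / 2"
        by (simp add: power2_eq_square algebra_simps)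
      also have "c u v * (u + v) = 2 * (u\<^sup>2 + u * v + v\<^sup>2) / 3"
      proof -
        have "p / (3 * w) * w = p / 3" if "w \<noteq> 0" for p w :: real using that by simp
        from this[OF sum] show ?thesis unfolding c_def .
      qed
      also have "2 * (u\<^sup>2 + u * v + v\<^sup>2) / 3 * (v - u) / 2 = (v ^ 3 - u ^ 3) / 3"
        by (simp add: power2_eq_square power3_eq_cube field_simps)
      finally show ?thesis .
    qed
    then have centroid: "lev j * (v\<^sup>2 - u\<^sup>2) / 2 = theta * (v ^ 3 - u ^ 3) / 3"
      unfolding lev_uv by (metis mult.assoc times_divide_eq_right)
    have l: "q y = lev j" if "y \<in> cell d j" for y using q[OF _ that] j by auto
    have l': "q y = - lev j" if "y \<in> cell d (- j)" for y using q[OF _ that] antisym[of j] j by auto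
    show ?thesis
      using E_I_eq[where q = q and l = "lev j" and ?i1.0 = i1, OF kappa theta d j l l'] centroid unfolding u_def v_def by simp
  qed
  have "E_I i1 (uniform_density kappa) theta d q j = 0" if "j \<in> {- int m..int m}" for j
  proof -
    consider "j = 0" | "0 < j" | "j < 0" by linarith
    then show ?thesis
    proof cases
      case 1
      then show ?thesis using set_lborel_integral_I_set_0[OF theta] by (simp add: E_I_def)
    next
      case 2
      then show ?thesis using pos[of j] that by auto
    next
      case 3
      then show ?thesis using pos[of "- j"] that by auto
    qed
  qed
  then show ?thesis using quant by (auto simp: feasible_def)
qed

lemma boundaries_of_nat:
  fixes b :: "nat \<Rightarrow> real"
  assumes "b 0 = 0" "b m = K" "\<And>j. j < m \<Longrightarrow> b j < b (Suc j)"
  shows "boundaries m K (\<lambda>j. if 0 \<le> j then b (nat j) else - b (nat (- j)))"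
  unfolding boundaries_def
proof (intro conjI ballI)
  fix j :: int assume "j \<in> {0..<int m}"
  then have "b (nat j) < b (Suc (nat j))" "nat (j + 1) = Suc (nat j)"
    by (auto intro!: assms(3))
  then show "(if 0 \<le> j then b (nat j) else - b (nat (- j))) <
      (if 0 \<le> j + 1 then b (nat (j + 1)) else - b (nat (- (j + 1))))"
    using \<open>j \<in> {0..<int m}\<close> by simp
qed (use assms in auto)

section \<open>Optimal quantizers\<close>

lemma V_feasible:
  fixes P :: "'w measure" and phi :: "'N::finite \<Rightarrow> 'w \<Rightarrow> real^'n::finite"
    and theta :: "real^'n" and T :: "real^'n^'n" and i1 :: 'n
  assumes P: "prob_space P"
    and T: "orthogonal_matrix T" "matrix_inv T *v theta = axis i1 theta1"
    and pos: "0 < theta1" "0 < kappa"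
    and X: "\<And>t. distributed P lborel (tregressor T phi t) (\<lambda>v. ennreal (uniform_density kappa v))"
    and uncorr: "uncorrelated_in_time P i1 (tregressor T phi)"
    and feas: "feasible m i1 (uniform_density kappa) theta1 (kappa * theta1) d q"
  shows "V P (\<lambda>w. transpose (Umat phi w ** T) *v Evec q theta phi w)
          = (\<Sum>k\<in>UNIV. \<integral>w. (\<Sum>t\<in>UNIV. tregressor T phi t w $ k
                * err q theta1 (tregressor T phi t w $ i1))\<^sup>2 \<partial>P)" (is ?norm)
    and "(\<Sum>k\<in>UNIV. \<integral>w. (\<Sum>t\<in>UNIV. tregressor T phi t w $ k
                * err q theta1 (tregressor T phi t w $ i1))\<^sup>2 \<partial>P)
          = real CARD('N) * (\<integral>x. sigma2 i1 (uniform_density kappa) x * (err q theta1 x)\<^sup>2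
              * marginal i1 (uniform_density kappa) x \<partial>lborel)" (is ?second)
proof -
  interpret prob_space P by (rule P)
  note e = feasible_err_bounded[OF pos(1) feas]
  obtain B where B: "\<bar>err q theta1 x\<bar> \<le> B" if "x \<in> {- kappa..kappa}" for x using e(2) by blast
  note cost = cost_of_time_sum[OF pos(2) X uncorr e(1) B feasible_mean_zero[OF pos(2,1) feas]]
  show ?second by (rule cost(1))
  show ?norm
    unfolding V_def power2_norm_eq_inner inner_vec_def rotated_correlation_nth[OF T]
    using cost(2) by (simp add: power2_eq_square)
qed

lemma V_feasible_cell_sum:
  fixes P :: "'w measure" and phi :: "'N::finite \<Rightarrow> 'w \<Rightarrow> real^'n::finite"
    and theta :: "real^'n" and T :: "real^'n^'n" and i1 :: 'n
  assumes P: "prob_space P"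
    and T: "orthogonal_matrix T" "matrix_inv T *v theta = axis i1 theta1"
    and pos: "0 < theta1" "0 < kappa"
    and X: "\<And>t. distributed P lborel (tregressor T phi t) (\<lambda>v. ennreal (uniform_density kappa v))"
    and uncorr: "uncorrelated_in_time P i1 (tregressor T phi)"
    and feas: "feasible m i1 (uniform_density kappa) theta1 (kappa * theta1) d q"
  shows "V P (\<lambda>w. transpose (Umat phi w) *v Evec q theta phi w)
      = real CARD('N) / (2160 * (kappa * theta1) * theta1\<^sup>2) *
        (\<Sum>i<m. cell_cost (20 * (kappa * theta1)\<^sup>2 * (real CARD('n) - 1)) (d (int i)) (d (int (Suc i))))"
  unfolding V_rotation_invariant[OF T(1)] V_feasible[OF assms]
    cost_sum_cells[OF pos(2,1) feas] ..

text \<open>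
  On feasible quantizers the cost is a positive multiple of the sum \<open>S d\<close> of the cell costs, which is
  bounded below by the value function, with equality iff all ratios minimize their stage. Since the
  bound is attained by a feasible quantizer, the optimal quantizers are those with equality.
\<close>

lemma optimal_iff_arg_min_stage:
  fixes P :: "'w measure" and phi :: "'N::finite \<Rightarrow> 'w \<Rightarrow> real^'n::finite"
    and theta :: "real^'n" and T :: "real^'n^'n" and i1 :: 'n
  assumes P: "prob_space P"
    and T: "orthogonal_matrix T" "matrix_inv T *v theta = axis i1 theta1"
    and pos: "0 < theta1" "0 < kappa" and K: "kappa_y = kappa * theta1"
    and X: "\<And>t. distributed P lborel (tregressor T phi t) (\<lambda>v. ennreal (uniform_density kappa v))"
    and uncorr: "uncorrelated_in_time P i1 (tregressor T phi)"
    and m: "1 \<le> m" and ro: "solves_recursion CARD('n) kappa_y m ro"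
  shows "\<exists>d q. optimal P phi theta m i1 (uniform_density kappa) theta1 kappa_y d q \<and>
             (\<forall>j\<in>{1..<m}. d (int j) = ro j (d (int j + 1)) * d (int j + 1))" (is ?attained)
    and "feasible m i1 (uniform_density kappa) theta1 kappa_y d q \<Longrightarrow>
             optimal P phi theta m i1 (uniform_density kappa) theta1 kappa_y d q \<longleftrightarrow>
               (\<forall>j\<in>{1..<m}. \<exists>r. d (int j) = r * d (int j + 1) \<and>
                  is_arg_min (stage CARD('n) kappa_y ro j (d (int j + 1))) (\<lambda>r. r \<in> {0..1}) r)"
    and "optimal P phi theta m i1 (uniform_density kappa) theta1 kappa_y d q \<Longrightarrow>
      feasible m i1 (uniform_density kappa) theta1 kappa_y d q \<and>
      V P (\<lambda>w. transpose (Umat phi w) *v Evec q theta phi w) =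
        real CARD('N) / 2160 * (kappa_y ^ 4 / theta1\<^sup>2)
                   * (psi_min ro (m - 1) kappa_y
                      + 20 * (real CARD('n) - 1) * xi_min ro (m - 1) kappa_y)"
proof -
  define mu where "mu = 20 * kappa_y\<^sup>2 * (real CARD('n) - 1)"
  define C where "C = real CARD('N) / (2160 * kappa_y * theta1\<^sup>2)"
  define cost where "cost q = V P (\<lambda>w. transpose (Umat phi w) *v Evec q theta phi w)" for q
  define S where "S d = (\<Sum>i\<le>m - 1. cell_cost mu (d (int i)) (d (int (Suc i))))" for d :: "int \<Rightarrow> real"
  let ?feas = "feasible m i1 (uniform_density kappa) theta1 kappa_y"
  let ?opt = "optimal P phi theta m i1 (uniform_density kappa) theta1 kappa_y"
  have mS: "m = Suc (m - 1)" using m by simp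
  have Ky: "0 < kappa_y" using pos K by simp
  have mu: "0 \<le> mu" by (simp add: mu_def Suc_leI)
  have C: "0 < C" using Ky pos by (simp add: C_def)
  have cost_eq: "cost q = C * S d" if "?feas d q" for d q
  proof -
    have "{..<m} = {..m - 1}" using m by auto
    then show ?thesis
      using V_feasible_cell_sum[OF P T pos X uncorr that[unfolded K]]
      by (simp add: cost_def C_def S_def mu_def K)
  qed
  have feas_d: "boundaries m kappa_y d" if "?feas d q" for d q
    using that by (auto simp: feasible_def quantizer_iff_boundaries)
  have d_less: "d (int j) < d (int (Suc j))" if "boundaries m kappa_y d" "j \<le> m - 1" for d j
    using boundaries_less[OF that(1), of "int j" "int (Suc j)"] that(2) m by simp
  have d_ends: "d (int 0) = 0" "d (int (Suc (m - 1))) = kappa_y" if "boundaries m kappa_y d" for d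
    using that m by (auto simp: boundaries_def)
  have S_ge: "opt_cost mu (m - 1) kappa_y \<le> S d"
    and S_eq: "S d = opt_cost mu (m - 1) kappa_y \<longleftrightarrow> (\<forall>j\<in>{1..m - 1}.
        is_arg_min (trial_cost mu (j - 1) (d (int (Suc j)))) (\<lambda>r. r \<in> {0..1}) (d (int j) / d (int (Suc j))))"
    if "boundaries m kappa_y d" for d
    using opt_cost_chain[where d = "\<lambda>j. d (int j)" and k = "m - 1" and mu = mu] d_less[OF that] d_ends[OF that]
    unfolding S_def by auto
  have stage_iff: "(\<exists>r. d (int j) = r * d (int j + 1) \<and>
          is_arg_min (stage CARD('n) kappa_y ro j (d (int j + 1))) (\<lambda>r. r \<in> {0..1}) r) \<longleftrightarrow>
      is_arg_min (trial_cost mu (j - 1) (d (int (Suc j)))) (\<lambda>r. r \<in> {0..1}) (d (int j) / d (int (Suc j)))"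
    if d: "boundaries m kappa_y d" and j: "j \<in> {1..<m}" for d j
  proof -
    have e: "d (int (Suc j)) \<in> {0<..kappa_y}"
      using boundaries_less[OF d, of 0 "int (Suc j)"] boundaries_le[OF d, of "int (Suc j)" "int m"] j d
      by (auto simp: boundaries_def)
    then have ratio: "d (int j) = r * d (int (Suc j)) \<longleftrightarrow> r = d (int j) / d (int (Suc j))" for r
      by (auto simp: field_simps)
    have suc: "int j + 1 = int (Suc j)" by simp
    show ?thesis
      unfolding suc ratio arg_min_stage_iff[OF mu_def ro j e] by blast
  qed
  have iff: "S d = opt_cost mu (m - 1) kappa_y \<longleftrightarrow> (\<forall>j\<in>{1..<m}. \<exists>r. d (int j) = r * d (int j + 1) \<and>
          is_arg_min (stage CARD('n) kappa_y ro j (d (int j + 1))) (\<lambda>r. r \<in> {0..1}) r)"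
    if "boundaries m kappa_y d" for d
  proof -
    have "{1..m - 1} = {1..<m}" using m by auto
    then show ?thesis unfolding S_eq[OF that] using stage_iff[OF that] by simp
  qed
  obtain d0 q0 where d0: "?feas d0 q0" "S d0 = opt_cost mu (m - 1) kappa_y"
    "\<forall>j\<in>{1..<m}. d0 (int j) = ro j (d0 (int j + 1)) * d0 (int j + 1)"
  proof -
    have am: "is_arg_min (stage CARD('n) kappa_y ro j e) (\<lambda>r. r \<in> {0..1}) (ro j e)"
      if "j \<in> {1..<m}" "e \<in> {0<..kappa_y}" for j e
      using ro that unfolding solves_recursion_def by blast
    have am_trial: "is_arg_min (trial_cost mu (j - 1) e) (\<lambda>r. r \<in> {0..1}) (ro j e)"
      if "j \<in> {1..m - 1}" "e \<in> {0<..kappa_y}" for j e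
    proof -
      have "j \<in> {1..<m}" using that m by auto
      then show ?thesis using am arg_min_stage_iff[OF mu_def ro _ that(2)] that(2) by blast
    qed
    obtain b where b: "b 0 = 0" "b (Suc (m - 1)) = kappa_y" "\<forall>j\<le>m - 1. b j < b (Suc j)"
      "\<forall>j\<in>{1..m - 1}. b j = ro j (b (Suc j)) * b (Suc j)"
      using opt_cost_attained[OF mu Ky am_trial] by blast
    define d where "d = (\<lambda>j::int. if 0 \<le> j then b (nat j) else - b (nat (- j)))"
    have d: "boundaries m kappa_y d"
      unfolding d_def by (rule boundaries_of_nat) (use b mS in auto)
    have d_nat: "d (int j) = b j" "d (int j + 1) = b (Suc j)" for j
      by (simp_all add: d_def nat_add_distrib)
    obtain q where q: "?feas d q" using feasible_exists[OF pos(2,1)] d K by blast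
    have ratio: "\<forall>j\<in>{1..<m}. d (int j) = ro j (d (int j + 1)) * d (int j + 1)"
    proof
      fix j assume "j \<in> {1..<m}"
      then have "j \<in> {1..m - 1}" by auto
      then show "d (int j) = ro j (d (int j + 1)) * d (int j + 1)" unfolding d_nat using b(4) by blast
    qed
    have "S d = opt_cost mu (m - 1) kappa_y"
      unfolding iff[OF d]
    proof
      fix j assume j: "j \<in> {1..<m}"
      have "d (int j + 1) \<in> {0<..kappa_y}"
        using boundaries_less[OF d, of 0 "int j + 1"] boundaries_le[OF d, of "int j + 1" "int m"] j d
        by (auto simp: boundaries_def)
      then show "\<exists>r. d (int j) = r * d (int j + 1) \<and>
          is_arg_min (stage CARD('n) kappa_y ro j (d (int j + 1))) (\<lambda>r. r \<in> {0..1}) r"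
        using ratio am[OF j] j by blast
    qed
    then show thesis using that q ratio by blast
  qed
  have opt_iff: "?opt d q \<longleftrightarrow> ?feas d q \<and> S d = opt_cost mu (m - 1) kappa_y" for d q
  proof
    assume opt: "?opt d q"
    then have f: "?feas d q" and min: "cost q \<le> cost q0"
      using d0(1) by (auto simp: optimal_def is_arg_min_iff_le cost_def)
    have "S d \<le> S d0"
      using min C unfolding cost_eq[OF f] cost_eq[OF d0(1)] by simp
    then show "?feas d q \<and> S d = opt_cost mu (m - 1) kappa_y"
      using f d0(2) S_ge[OF feas_d[OF f]] by auto
  next
    assume f: "?feas d q \<and> S d = opt_cost mu (m - 1) kappa_y"
    have "cost q \<le> cost q'" if "?feas d' q'" for d' q'
      using f that cost_eq S_ge[OF feas_d[OF that]] C by (auto simp: cost_eq[OF that])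
    then show "?opt d q"
      using f by (auto simp: optimal_def is_arg_min_iff_le cost_def)
  qed
  show ?attained using d0 opt_iff by blast
  show "?opt d q \<longleftrightarrow> (\<forall>j\<in>{1..<m}. \<exists>r. d (int j) = r * d (int j + 1) \<and>
          is_arg_min (stage CARD('n) kappa_y ro j (d (int j + 1))) (\<lambda>r. r \<in> {0..1}) r)"
    if "?feas d q"
    using opt_iff that iff[OF feas_d[OF that]] by blast
  assume "?opt d q"
  then have f: "?feas d q" and S: "S d = opt_cost mu (m - 1) kappa_y" using opt_iff by auto
  have "opt_cost mu (m - 1) kappa_y = recursion_value mu ro (m - 1) kappa_y"
  proof (rule recursion_value_eq_opt_cost[OF mu_def, symmetric])
    have "{1..m - 1} = {1..<m}" using m by auto
    then show "\<forall>j\<in>{1..m - 1}. \<forall>d\<in>{0<..kappa_y}.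
        is_arg_min (stage CARD('n) kappa_y ro j d) (\<lambda>r. r \<in> {0..1}) (ro j d)"
      using ro by (simp only: solves_recursion_def)
  qed (use Ky in simp)
  also have "\<dots> = kappa_y ^ 5 * (psi_min ro (m - 1) kappa_y + 20 * (real CARD('n) - 1) * xi_min ro (m - 1) kappa_y)"
    by (simp add: recursion_value_def mu_def algebra_simps eval_nat_numeral)
  finally have "cost q = C * (kappa_y ^ 5 * (psi_min ro (m - 1) kappa_y + 20 * (real CARD('n) - 1) * xi_min ro (m - 1) kappa_y))"
    using cost_eq[OF f] S by simp
  also have "\<dots> = (C * kappa_y ^ 5) * (psi_min ro (m - 1) kappa_y + 20 * (real CARD('n) - 1) * xi_min ro (m - 1) kappa_y)"
    by simp
  also have "C * kappa_y ^ 5 = real CARD('N) / 2160 * (kappa_y ^ 4 / theta1\<^sup>2)"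
    using Ky by (simp add: C_def eval_nat_numeral)
  finally show "?feas d q \<and> V P (\<lambda>w. transpose (Umat phi w) *v Evec q theta phi w) =
        real CARD('N) / 2160 * (kappa_y ^ 4 / theta1\<^sup>2)
                   * (psi_min ro (m - 1) kappa_y
                      + 20 * (real CARD('n) - 1) * xi_min ro (m - 1) kappa_y)"
    using f by (simp add: cost_def)
qed

theorem proposition4p1:
  fixes P :: "'w measure"
    and phi :: "'N::finite \<Rightarrow> 'w \<Rightarrow> real^'n::finite"
    and theta :: "real^'n" and T :: "real^'n^'n" and i1 :: 'n
    and theta1 kappa kappa_y :: real and M m :: nat
    and f :: "real^'n \<Rightarrow> real"
  assumes "prob_space P"
    and "orthogonal_matrix T" and "matrix_inv T *v theta = axis i1 theta1"
    and "theta1 > 0" and "kappa > 0" and "kappa_y = kappa * theta1"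
    and "f = uniform_density kappa"
    and "\<And>t. distributed P lborel (tregressor T phi t) f"
    and "uncorrelated_in_time P i1 (tregressor T phi)"
    and "M \<ge> 2" and "m = M div 2"
  shows
    "(\<forall>d q. feasible m i1 f theta1 kappa_y d q \<longrightarrow>
        V P (\<lambda>w. transpose (Umat phi w) *v Evec q theta phi w)
          = V P (\<lambda>w. transpose (Umat phi w ** T) *v Evec q theta phi w) \<and>
        V P (\<lambda>w. transpose (Umat phi w ** T) *v Evec q theta phi w)
          = (\<Sum>k\<in>UNIV. \<integral>w. (\<Sum>t\<in>UNIV. tregressor T phi t w $ k
                * err q theta1 (tregressor T phi t w $ i1))\<^sup>2 \<partial>P) \<and>
        (\<Sum>k\<in>UNIV. \<integral>w. (\<Sum>t\<in>UNIV. tregressor T phi t w $ k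
                * err q theta1 (tregressor T phi t w $ i1))\<^sup>2 \<partial>P)
          = real CARD('N) * (\<integral>x. sigma2 i1 f x * (err q theta1 x)\<^sup>2 * marginal i1 f x \<partial>lborel))
     \<and> (\<exists>ro. solves_recursion CARD('n) kappa_y m ro)
     \<and> (\<forall>ro. solves_recursion CARD('n) kappa_y m ro \<longrightarrow>
          (\<exists>d q. optimal P phi theta m i1 f theta1 kappa_y d q \<and>
             (\<forall>j\<in>{1..<m}. d (int j) = ro j (d (int j + 1)) * d (int j + 1)))
        \<and> (\<forall>d q. feasible m i1 f theta1 kappa_y d q \<longrightarrow>
             (optimal P phi theta m i1 f theta1 kappa_y d q \<longleftrightarrow>
               (\<forall>j\<in>{1..<m}. \<exists>r. d (int j) = r * d (int j + 1) \<and>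
                  is_arg_min (stage CARD('n) kappa_y ro j (d (int j + 1))) (\<lambda>r. r \<in> {0..1}) r)))
        \<and> (\<forall>d q. optimal P phi theta m i1 f theta1 kappa_y d q \<longrightarrow>
             V P (\<lambda>w. transpose (Umat phi w) *v Evec q theta phi w)
               = (\<Sum>j\<in>{- int m..int m}. V_I CARD('N) i1 f theta1 d q j) \<and>
             (\<Sum>j\<in>{- int m..int m}. V_I CARD('N) i1 f theta1 d q j)
               = real CARD('N) / 2160 * (kappa_y ^ 4 / theta1\<^sup>2)
                   * (psi_min ro (m - 1) kappa_y
                      + 20 * (real CARD('n) - 1) * xi_min ro (m - 1) kappa_y) \<and>
             real CARD('N) / 2160 * (kappa_y ^ 4 / theta1\<^sup>2)
                   * (psi_min ro (m - 1) kappa_y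
                      + 20 * (real CARD('n) - 1) * xi_min ro (m - 1) kappa_y)
               = real CARD('N) / 2160 * (theta1\<^sup>2 * kappa ^ 4)
                   * (psi_min ro (m - 1) kappa_y
                      + 20 * (real CARD('n) - 1) * xi_min ro (m - 1) kappa_y)))"
proof -
  have X: "\<And>t. distributed P lborel (tregressor T phi t) (\<lambda>v. ennreal (uniform_density kappa v))"
    using assms(8) unfolding assms(7) .
  have m: "1 \<le> m" using \<open>M \<ge> 2\<close> \<open>m = M div 2\<close> by auto
  note setting = assms(1-5) X \<open>uncorrelated_in_time P i1 (tregressor T phi)\<close>
  note optimality = optimal_iff_arg_min_stage[OF assms(1-6) X assms(9) m, folded assms(7)]
  have power: "real CARD('N) / 2160 * (kappa_y ^ 4 / theta1\<^sup>2) = real CARD('N) / 2160 * (theta1\<^sup>2 * kappa ^ 4)"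
    using \<open>theta1 > 0\<close> by (simp add: assms(6) power_mult_distrib eval_nat_numeral)
  have feasible_cost: "V P (\<lambda>w. transpose (Umat phi w ** T) *v Evec q theta phi w)
          = (\<Sum>k\<in>UNIV. \<integral>w. (\<Sum>t\<in>UNIV. tregressor T phi t w $ k
                * err q theta1 (tregressor T phi t w $ i1))\<^sup>2 \<partial>P)"
       "(\<Sum>k\<in>UNIV. \<integral>w. (\<Sum>t\<in>UNIV. tregressor T phi t w $ k
                * err q theta1 (tregressor T phi t w $ i1))\<^sup>2 \<partial>P)
          = real CARD('N) * (\<integral>x. sigma2 i1 f x * (err q theta1 x)\<^sup>2 * marginal i1 f x \<partial>lborel)"
       "real CARD('N) * (\<integral>x. sigma2 i1 f x * (err q theta1 x)\<^sup>2 * marginal i1 f x \<partial>lborel)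
          = (\<Sum>j\<in>{- int m..int m}. V_I CARD('N) i1 f theta1 d q j)"
    if "feasible m i1 f theta1 kappa_y d q" for d q
    using V_feasible[OF setting, of m d q] cost_sum_cells(1)[OF assms(5,4), of m i1 d q] that
    unfolding assms(6,7) by simp_all
  note rotation = V_rotation_invariant[OF assms(2), of P phi]
  have optimal_value: "V P (\<lambda>w. transpose (Umat phi w) *v Evec q theta phi w)
               = (\<Sum>j\<in>{- int m..int m}. V_I CARD('N) i1 f theta1 d q j) \<and>
             (\<Sum>j\<in>{- int m..int m}. V_I CARD('N) i1 f theta1 d q j)
               = real CARD('N) / 2160 * (kappa_y ^ 4 / theta1\<^sup>2)
                   * (psi_min ro (m - 1) kappa_y
                      + 20 * (real CARD('n) - 1) * xi_min ro (m - 1) kappa_y)"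
    if ro: "solves_recursion CARD('n) kappa_y m ro"
      and opt: "optimal P phi theta m i1 f theta1 kappa_y d q" for ro d q
  proof -
    have feas: "feasible m i1 f theta1 kappa_y d q" using optimality(3)[OF ro opt] by blast
    show ?thesis
      using optimality(3)[OF ro opt] rotation[of q theta] feasible_cost[OF feas] by metis
  qed
  show ?thesis
  proof (intro conjI allI impI)
    show "\<exists>ro. solves_recursion CARD('n) kappa_y m ro" by (rule solves_recursion_exists)
  next
    fix ro assume "solves_recursion CARD('n) kappa_y m ro"
    then show "\<exists>d q. optimal P phi theta m i1 f theta1 kappa_y d q \<and>
        (\<forall>j\<in>{1..<m}. d (int j) = ro j (d (int j + 1)) * d (int j + 1))"
      by (rule optimality(1))
  next
    fix ro d q assume "solves_recursion CARD('n) kappa_y m ro" "feasible m i1 f theta1 kappa_y d q"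
    then show "optimal P phi theta m i1 f theta1 kappa_y d q \<longleftrightarrow>
        (\<forall>j\<in>{1..<m}. \<exists>r. d (int j) = r * d (int j + 1) \<and>
            is_arg_min (stage CARD('n) kappa_y ro j (d (int j + 1))) (\<lambda>r. r \<in> {0..1}) r)"
      by (rule optimality(2))
  qed (use rotation feasible_cost optimal_value power in \<open>simp_all only:\<close>)
qed

end
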